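(* Let $b,c,d,\varrho\in\mathbb{R}$, $a,\lambda,\sigma>0$, $\rho\in(-1,1)$, $T>0$, $f:\mathbb{R}\times\mathbb{R}_+\to\mathbb{R}$, and let $h\in\mathcal{C}([0,T)\times\mathbb{R}\times\mathbb{R}_+)$ have polynomial growth in $(x,y)$ uniformly in $t$. Let $w$ be an upper semicontinuous function and $v$ a lower semicontinuous function on $[0,T]\times\mathbb{R}\times\mathbb{R}_+$, both with polynomial growth in $(x,y)$ uniformly in time, which are respectively a viscosity sub-solution and a viscosity super-solution, with initial value $f$, of $$\partial_su+F(s,(x,y),u,D_{(x,y)}u,D^2_{(x,y)}u)=0,\quad s\in(0,T],\ (x,y)\in\mathbb{R}\times\mathbb{R}_+,$$ where $$F(s,(x,y),r,p,M)=-\frac y2(\lambda^2M_{11}+2\rho\lambda\sigma M_{12}+\sigma^2M_{22})-(c+dy)p_1-(a-by)p_2-\varrho r+h(T-s,x,y).$$ Then $w\le v$ on $[0,T]\times\mathbb{R}\times\mathbb{R}_+$.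
   Context: $\mathbb{R}_+=[0,\infty)$, $\mathcal{O}=\mathbb{R}\times\mathbb{R}_+$. Polynomial growth of $g$ in $(x,y)$ uniformly in $t$: $|g(t,x,y)|\le C(1+|x|^L+y^L)$ with $C,L>0$ independent of $t$. A function $w:[0,T]\times\mathcal{O}\to\mathbb{R}$, upper (resp. lower) semicontinuous on $(0,T]\times\mathcal{O}$, is a viscosity sub-solution (resp. super-solution) with initial value $f$ if: (i) for every $(s,z)\in(0,T]\times\mathcal{O}$ (points with $y=0$ included) and every smooth $\phi$ such that $w-\phi$ has a local maximum (resp. minimum), relative to $(0,T]\times\mathcal{O}$, at $(s,z)$, one has $\partial_s\phi(s,z)+F(s,z,w(s,z),D\phi(s,z),D^2\phi(s,z))\le0$ (resp. $\ge0$); (ii) $w(0,\cdot)\le f$ (resp. $\ge f$) on $\mathcal{O}$. *)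

theory Defs
  imports "HOL-Analysis.Analysis"
begin

text \<open>Points of \<open>[0,T] \<times> \<real> \<times> \<real>\<^sub>+\<close> are triples \<open>(s, x, y) = (s, (x, y))\<close>. Functions on such
  domains are total in HOL; every notion below only looks at their values on the given domain.\<close>

definition half_plane :: "(real \<times> real) set" where
  "half_plane = UNIV \<times> {0..}"

definition upper_semicontinuous_on :: "'a::topological_space set \<Rightarrow> ('a \<Rightarrow> real) \<Rightarrow> bool" where
  "upper_semicontinuous_on S g \<longleftrightarrow>
     (\<forall>p\<in>S. \<forall>c. g p < c \<longrightarrow> (\<forall>\<^sub>F q in at p within S. g q < c))"

definition lower_semicontinuous_on :: "'a::topological_space set \<Rightarrow> ('a \<Rightarrow> real) \<Rightarrow> bool" where
  "lower_semicontinuous_on S g \<longleftrightarrow>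
     (\<forall>p\<in>S. \<forall>c. c < g p \<longrightarrow> (\<forall>\<^sub>F q in at p within S. c < g q))"

text \<open>The exponent \<open>L\<close> is real, hence \<open>powr\<close>; note \<open>0 powr L = 0\<close>.\<close>

definition polynomial_growth_on :: "real set \<Rightarrow> (real \<times> real \<times> real \<Rightarrow> real) \<Rightarrow> bool" where
  "polynomial_growth_on I g \<longleftrightarrow>
     (\<exists>C>0. \<exists>L>0. \<forall>t\<in>I. \<forall>(x, y)\<in>half_plane. \<bar>g (t, x, y)\<bar> \<le> C * (1 + \<bar>x\<bar> powr L + y powr L))"

text \<open>\<open>C\<^sup>k\<close> and \<open>C\<^sup>\<infinity>\<close> functions on a whole (finite-dimensional) space, by iterated directional
  derivatives.\<close>

primrec C_times_differentiable :: "nat \<Rightarrow> ('a::euclidean_space \<Rightarrow> real) \<Rightarrow> bool" where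
  "C_times_differentiable 0 \<phi> \<longleftrightarrow> continuous_on UNIV \<phi>"
| "C_times_differentiable (Suc k) \<phi> \<longleftrightarrow>
     (\<forall>p. \<phi> differentiable (at p)) \<and>
     (\<forall>v. C_times_differentiable k (\<lambda>p. frechet_derivative \<phi> (at p) v))"

definition smooth :: "('a::euclidean_space \<Rightarrow> real) \<Rightarrow> bool" where
  "smooth \<phi> \<longleftrightarrow> (\<forall>k. C_times_differentiable k \<phi>)"

definition time_deriv :: "(real \<times> real \<times> real \<Rightarrow> real) \<Rightarrow> real \<times> real \<times> real \<Rightarrow> real" where
  "time_deriv \<phi> p = frechet_derivative \<phi> (at p) (1, 0, 0)"

definition space_dir :: "2 \<Rightarrow> real \<times> real \<times> real" where
  "space_dir i = (if i = 1 then (0, 1, 0) else (0, 0, 1))"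

definition space_grad :: "(real \<times> real \<times> real \<Rightarrow> real) \<Rightarrow> real \<times> real \<times> real \<Rightarrow> real^2" where
  "space_grad \<phi> p = (\<chi> i. frechet_derivative \<phi> (at p) (space_dir i))"

definition space_hess :: "(real \<times> real \<times> real \<Rightarrow> real) \<Rightarrow> real \<times> real \<times> real \<Rightarrow> real^2^2" where
  "space_hess \<phi> p =
     (\<chi> i j. frechet_derivative (\<lambda>q. frechet_derivative \<phi> (at q) (space_dir j)) (at p) (space_dir i))"

definition local_max_on :: "'a::topological_space set \<Rightarrow> ('a \<Rightarrow> real) \<Rightarrow> 'a \<Rightarrow> bool" where
  "local_max_on S g p \<longleftrightarrow> p \<in> S \<and> (\<forall>\<^sub>F q in at p within S. g q \<le> g p)"

definition local_min_on :: "'a::topological_space set \<Rightarrow> ('a \<Rightarrow> real) \<Rightarrow> 'a \<Rightarrow> bool" where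
  "local_min_on S g p \<longleftrightarrow> p \<in> S \<and> (\<forall>\<^sub>F q in at p within S. g p \<le> g q)"

text \<open>Viscosity sub- and super-solutions of \<open>\<partial>\<^sub>s u + F (s, z, u, D u, D\<^sup>2 u) = 0\<close> on
  \<open>(0,T] \<times> half_plane\<close> with initial value \<open>f\<close>. The equation is also imposed on the
  boundary \<open>y = 0\<close> and at the final time \<open>s = T\<close>, where the extrema are one-sided.\<close>

definition viscosity_subsolution ::
  "real \<Rightarrow> (real \<Rightarrow> real \<times> real \<Rightarrow> real \<Rightarrow> real^2 \<Rightarrow> real^2^2 \<Rightarrow> real)
    \<Rightarrow> (real \<times> real \<Rightarrow> real) \<Rightarrow> (real \<times> real \<times> real \<Rightarrow> real) \<Rightarrow> bool" where
  "viscosity_subsolution T F f w \<longleftrightarrow>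
     upper_semicontinuous_on ({0<..T} \<times> half_plane) w \<and>
     (\<forall>s\<in>{0<..T}. \<forall>z\<in>half_plane. \<forall>\<phi>. smooth \<phi> \<longrightarrow>
        local_max_on ({0<..T} \<times> half_plane) (\<lambda>q. w q - \<phi> q) (s, z) \<longrightarrow>
        time_deriv \<phi> (s, z) + F s z (w (s, z)) (space_grad \<phi> (s, z)) (space_hess \<phi> (s, z)) \<le> 0) \<and>
     (\<forall>z\<in>half_plane. w (0, z) \<le> f z)"

definition viscosity_supersolution ::
  "real \<Rightarrow> (real \<Rightarrow> real \<times> real \<Rightarrow> real \<Rightarrow> real^2 \<Rightarrow> real^2^2 \<Rightarrow> real)
    \<Rightarrow> (real \<times> real \<Rightarrow> real) \<Rightarrow> (real \<times> real \<times> real \<Rightarrow> real) \<Rightarrow> bool" where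
  "viscosity_supersolution T F f v \<longleftrightarrow>
     lower_semicontinuous_on ({0<..T} \<times> half_plane) v \<and>
     (\<forall>s\<in>{0<..T}. \<forall>z\<in>half_plane. \<forall>\<phi>. smooth \<phi> \<longrightarrow>
        local_min_on ({0<..T} \<times> half_plane) (\<lambda>q. v q - \<phi> q) (s, z) \<longrightarrow>
        time_deriv \<phi> (s, z) + F s z (v (s, z)) (space_grad \<phi> (s, z)) (space_hess \<phi> (s, z)) \<ge> 0) \<and>
     (\<forall>z\<in>half_plane. v (0, z) \<ge> f z)"

end

theory Submission
  imports Defs
begin

text \<open>
  The equation is linear, so the two semicontinuous functions can be compared with smooth functions
  instead of with each other, and no doubling of variables is needed. Let \<open>L\<close> be the spatial
  operator. Since \<open>L\<close> does not raise the degree of a polynomial, \<open>exp (t L)\<close> acts on polynomials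
  through a convergent series, and its truncations are polynomial solutions of the equation up to an
  arbitrarily small error, for polynomial initial value and source. Polynomials are dense in the
  continuous functions of subexponential growth with respect to the weight \<open>exp (\<epsilon> (|x| + y))\<close>,
  and a barrier \<open>\<psi>\<close> with \<open>\<partial>\<^sub>s \<psi> - L \<psi> \<ge> \<psi>\<close> above that weight exists. Hence on \<open>[s\<^sub>1, T]\<close>, with \<open>s\<^sub>1 > 0\<close>
  (the source may be discontinuous at \<open>s = 0\<close>)
  so small that \<open>w\<close> lies below \<open>v\<close> at time \<open>s\<^sub>1\<close> up to \<open>\<eta>\<psi>\<close>, there is a smooth \<open>u\<close> which solves the
  equation up to \<open>\<eta>\<psi>\<close> and lies between \<open>w\<close> and \<open>v\<close> at time \<open>s\<^sub>1\<close> up to a multiple of \<open>\<eta>\<psi>\<close>. Testing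
  with \<open>u + M \<psi>\<close> gives \<open>w \<le> u + 5\<eta>\<psi>\<close>; by linearity \<open>- v\<close> is a sub-solution of the equation with
  source \<open>- h\<close>, which gives \<open>- v \<le> - u + 5\<eta>\<psi>\<close>. Let \<open>\<eta>\<close> tend to \<open>0\<close>.
\<close>

section \<open>Calculus of smooth functions\<close>

text \<open>The derivative in direction \<open>v\<close> as an operator from functions to functions:
  iterated derivatives become compositions, and the product and chain rules become rewrite equations
  between functions.\<close>

definition dir_deriv :: "'a::euclidean_space \<Rightarrow> ('a \<Rightarrow> real) \<Rightarrow> 'a \<Rightarrow> real" where
  "dir_deriv v \<phi> p = frechet_derivative \<phi> (at p) v"

lemma dir_deriv_eqI:
  assumes "\<And>p. (\<phi> has_derivative \<phi>' p) (at p)"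
  shows "dir_deriv v \<phi> = (\<lambda>p. \<phi>' p v)"
  using frechet_derivative_at[OF assms] by (simp add: dir_deriv_def fun_eq_iff)

text \<open>Reduces order \<open>Suc k\<close> to order \<open>k\<close> of an explicit derivative
  formula, so the closure properties below go by induction on the order without evaluating
  \<open>frechet_derivative\<close>.\<close>

lemma C_times_differentiable_SucI:
  assumes "\<And>p. (\<phi> has_derivative \<phi>' p) (at p)"
    and "\<And>v. C_times_differentiable k (\<lambda>p. \<phi>' p v)"
  shows "C_times_differentiable (Suc k) \<phi>"
  using assms dir_deriv_eqI[OF assms(1)]
  by (auto simp: differentiable_def dir_deriv_def fun_eq_iff)

lemma C_times_differentiable_SucD:
  assumes "C_times_differentiable (Suc k) \<phi>"
  shows "(\<phi> has_derivative (\<lambda>v. dir_deriv v \<phi> p)) (at p)"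
    and "C_times_differentiable k (dir_deriv v \<phi>)"
  using assms frechet_derivative_works[of \<phi> "at p"] by (auto simp: dir_deriv_def[abs_def])

lemma C_times_differentiable_le:
  "C_times_differentiable (Suc k) \<phi> \<Longrightarrow> C_times_differentiable k \<phi>"
proof (induction k arbitrary: \<phi>)
  case 0
  then show ?case
    by (auto simp: continuous_on_eq_continuous_at differentiable_imp_continuous_within)
next
  case (Suc k)
  then show ?case by auto
qed

lemma C_times_differentiable_const: "C_times_differentiable k (\<lambda>p. r)"
proof (induction k arbitrary: r)
  case (Suc k)
  show ?case
    by (rule C_times_differentiable_SucI[where \<phi>' = "\<lambda>p v. 0"]) (use Suc in auto)
qed auto

lemma C_times_differentiable_bounded_linear:
  assumes "bounded_linear f"
  shows "C_times_differentiable k f"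
proof (cases k)
  case 0
  then show ?thesis using assms by (auto intro: linear_continuous_on)
next
  case (Suc l)
  show ?thesis unfolding Suc
    by (rule C_times_differentiable_SucI[where \<phi>' = "\<lambda>p. f"])
       (auto intro: bounded_linear_imp_has_derivative assms C_times_differentiable_const)
qed

lemma C_times_differentiable_add:
  assumes "C_times_differentiable k f" "C_times_differentiable k g"
  shows "C_times_differentiable k (\<lambda>p. f p + g p)"
  using assms
proof (induction k arbitrary: f g)
  case 0
  then show ?case by (auto intro: continuous_intros)
next
  case (Suc k)
  show ?case
    by (rule C_times_differentiable_SucI[where \<phi>' = "\<lambda>p v. dir_deriv v f p + dir_deriv v g p"])
       (auto intro!: has_derivative_add Suc C_times_differentiable_SucD)
qed

lemma C_times_differentiable_mult:
  assumes "C_times_differentiable k f" "C_times_differentiable k g"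
  shows "C_times_differentiable k (\<lambda>p. f p * g p)"
  using assms
proof (induction k arbitrary: f g)
  case 0
  then show ?case by (auto intro: continuous_intros)
next
  case (Suc k)
  show ?case
    \<comment> \<open>The product rule leaves \<open>f\<close> and \<open>g\<close> undifferentiated
      in each summand, so the induction hypothesis also needs them at the lower order; hence
      \<open>C_times_differentiable_le\<close>.\<close>
    by (rule C_times_differentiable_SucI
          [where \<phi>' = "\<lambda>p v. f p * dir_deriv v g p + dir_deriv v f p * g p"])
       (auto intro!: has_derivative_mult Suc.IH Suc.prems C_times_differentiable_SucD
          C_times_differentiable_add Suc.prems[THEN C_times_differentiable_le])
qed

lemma C_times_differentiable_exp:
  assumes "C_times_differentiable k f"
  shows "C_times_differentiable k (\<lambda>p. exp (f p))"
  using assms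
proof (induction k)
  case 0
  then show ?case by (auto intro: continuous_intros)
next
  case (Suc k)
  show ?case
  proof (rule C_times_differentiable_SucI[where \<phi>' = "\<lambda>p v. exp (f p) * dir_deriv v f p"])
    show "((\<lambda>p. exp (f p)) has_derivative (\<lambda>v. exp (f p) * dir_deriv v f p)) (at p)" for p
      using has_derivative_exp[OF C_times_differentiable_SucD(1)[OF Suc.prems]]
      by (simp add: mult.commute)
    show "C_times_differentiable k (\<lambda>p. exp (f p) * dir_deriv v f p)" for v
      by (intro C_times_differentiable_mult Suc.IH C_times_differentiable_SucD Suc.prems
          C_times_differentiable_le)
  qed
qed

named_theorems smooth_intros

lemma smooth_const [smooth_intros]: "smooth (\<lambda>p. r)"
  by (simp add: smooth_def C_times_differentiable_const)

lemma smooth_bounded_linear: "bounded_linear f \<Longrightarrow> smooth f"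
  by (simp add: smooth_def C_times_differentiable_bounded_linear)

lemma smooth_add [smooth_intros]: "smooth f \<Longrightarrow> smooth g \<Longrightarrow> smooth (\<lambda>p. f p + g p)"
  by (simp add: smooth_def C_times_differentiable_add)

lemma smooth_mult [smooth_intros]: "smooth f \<Longrightarrow> smooth g \<Longrightarrow> smooth (\<lambda>p. f p * g p)"
  by (simp add: smooth_def C_times_differentiable_mult)

lemma smooth_exp [smooth_intros]: "smooth f \<Longrightarrow> smooth (\<lambda>p. exp (f p))"
  by (simp add: smooth_def C_times_differentiable_exp)

lemma smooth_uminus [smooth_intros]: "smooth f \<Longrightarrow> smooth (\<lambda>p. - f p)"
  using smooth_mult[OF smooth_const[of "-1"]] by simp

lemma smooth_diff [smooth_intros]: "smooth f \<Longrightarrow> smooth g \<Longrightarrow> smooth (\<lambda>p. f p - g p)"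
  using smooth_add[OF _ smooth_uminus, of f g] by simp

lemma smooth_power [smooth_intros]: "smooth f \<Longrightarrow> smooth (\<lambda>p. f p ^ n)"
  by (induction n) (auto intro: smooth_intros)

lemma smooth_sum [smooth_intros]:
  "(\<And>i. i \<in> A \<Longrightarrow> smooth (f i)) \<Longrightarrow> smooth (\<lambda>p. \<Sum>i\<in>A. f i p)"
  by (induction A rule: infinite_finite_induct) (auto intro: smooth_intros)

lemma smooth_coordinates [smooth_intros]:
  "smooth (fst :: real \<times> real \<times> real \<Rightarrow> real)"
  "smooth (\<lambda>p :: real \<times> real \<times> real. fst (snd p))"
  "smooth (\<lambda>p :: real \<times> real \<times> real. snd (snd p))"
  by (rule smooth_bounded_linear bounded_linear_fst bounded_linear_fst_comp bounded_linear_snd_comp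
      bounded_linear_snd)+

lemma smooth_imp_has_derivative:
  "smooth f \<Longrightarrow> (f has_derivative (\<lambda>v. dir_deriv v f p)) (at p)"
  unfolding smooth_def using C_times_differentiable_SucD(1) by blast

lemma smooth_dir_deriv [smooth_intros]: "smooth f \<Longrightarrow> smooth (dir_deriv v f)"
  unfolding smooth_def using C_times_differentiable_SucD(2) by blast

lemma smooth_imp_continuous_on: "smooth f \<Longrightarrow> continuous_on A f"
  using smooth_def[of f] C_times_differentiable.simps(1) continuous_on_subset by blast

section \<open>Rules of differentiation for directional derivatives\<close>

lemma dir_deriv_const: "dir_deriv v (\<lambda>p. r) = (\<lambda>p. 0)"
  by (rule dir_deriv_eqI) simp

lemma dir_deriv_coordinates:
  "dir_deriv v (fst :: real \<times> real \<times> real \<Rightarrow> real) = (\<lambda>p. fst v)"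
  "dir_deriv v (\<lambda>p :: real \<times> real \<times> real. fst (snd p)) = (\<lambda>p. fst (snd v))"
  "dir_deriv v (\<lambda>p :: real \<times> real \<times> real. snd (snd p)) = (\<lambda>p. snd (snd v))"
  by (rule dir_deriv_eqI, auto intro!: derivative_eq_intros)+

lemma dir_deriv_add:
  "smooth f \<Longrightarrow> smooth g \<Longrightarrow> dir_deriv v (\<lambda>p. f p + g p) = (\<lambda>p. dir_deriv v f p + dir_deriv v g p)"
  by (rule dir_deriv_eqI) (intro has_derivative_add smooth_imp_has_derivative)

lemma dir_deriv_mult:
  "smooth f \<Longrightarrow> smooth g \<Longrightarrow>
    dir_deriv v (\<lambda>p. f p * g p) = (\<lambda>p. f p * dir_deriv v g p + dir_deriv v f p * g p)"
  by (rule dir_deriv_eqI) (intro has_derivative_mult smooth_imp_has_derivative)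

lemma dir_deriv_cmult:
  "smooth f \<Longrightarrow> dir_deriv v (\<lambda>p. r * f p) = (\<lambda>p. r * dir_deriv v f p)"
  by (simp add: dir_deriv_mult smooth_const dir_deriv_const)

lemma dir_deriv_exp:
  "smooth f \<Longrightarrow> dir_deriv v (\<lambda>p. exp (f p)) = (\<lambda>p. exp (f p) * dir_deriv v f p)"
  by (rule dir_deriv_eqI) (use has_derivative_exp[OF smooth_imp_has_derivative] in \<open>simp add: mult.commute\<close>)

lemma dir_deriv_power:
  "smooth f \<Longrightarrow> dir_deriv v (\<lambda>p. f p ^ n) = (\<lambda>p. real n * f p ^ (n - 1) * dir_deriv v f p)"
  by (rule dir_deriv_eqI)
     (use has_derivative_power[OF smooth_imp_has_derivative] in \<open>simp add: algebra_simps\<close>)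

lemma dir_deriv_diff:
  "smooth f \<Longrightarrow> smooth g \<Longrightarrow> dir_deriv v (\<lambda>p. f p - g p) = (\<lambda>p. dir_deriv v f p - dir_deriv v g p)"
  by (rule dir_deriv_eqI) (intro has_derivative_diff smooth_imp_has_derivative)

lemmas dir_deriv_simps = dir_deriv_const dir_deriv_coordinates dir_deriv_add dir_deriv_mult
  dir_deriv_exp dir_deriv_power dir_deriv_diff

section \<open>Polynomial approximation in exponential weights\<close>

text \<open>An exponential of the l1-norm of the space point: on the half plane \<open>y\<close> is
  its own absolute value. Time does not enter.\<close>

definition exp_weight :: "real \<Rightarrow> real \<times> real \<times> real \<Rightarrow> real" where
  "exp_weight \<epsilon> p = exp (\<epsilon> * (\<bar>fst (snd p)\<bar> + snd (snd p)))"

lemma exp_weight_pos: "0 < exp_weight \<epsilon> p"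
  by (simp add: exp_weight_def)

lemma exp_weight_add: "exp_weight (\<epsilon> + \<delta>) p = exp_weight \<epsilon> p * exp_weight \<delta> p"
  by (simp add: exp_weight_def exp_add[symmetric] algebra_simps)

lemma mem_half_plane: "p \<in> I \<times> half_plane \<longleftrightarrow> fst p \<in> I \<and> 0 \<le> snd (snd p)"
  by (cases p) (auto simp: half_plane_def)

lemma exp_weight_ge_1:
  "0 \<le> \<epsilon> \<Longrightarrow> p \<in> I \<times> half_plane \<Longrightarrow> 1 \<le> exp_weight \<epsilon> p"
  by (simp add: exp_weight_def mem_half_plane)

lemma exp_weight_mono:
  "\<epsilon> \<le> \<delta> \<Longrightarrow> p \<in> I \<times> half_plane \<Longrightarrow> exp_weight \<epsilon> p \<le> exp_weight \<delta> p"
  by (simp add: exp_weight_def mem_half_plane mult_right_mono)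

lemma continuous_on_exp_weight [continuous_intros]: "continuous_on A (exp_weight \<epsilon>)"
  unfolding exp_weight_def[abs_def] by (intro continuous_intros)

text \<open>Growth below every exponential weight, uniformly in time. It covers polynomial growth,
  and the freedom in \<epsilon> gives closure under products, by giving each factor half of the
  exponent.\<close>

definition subexponential_on :: "real set \<Rightarrow> (real \<times> real \<times> real \<Rightarrow> real) \<Rightarrow> bool" where
  "subexponential_on I g \<longleftrightarrow>
     (\<forall>\<epsilon>>0. \<exists>C. \<forall>p\<in>I \<times> half_plane. \<bar>g p\<bar> \<le> C * exp_weight \<epsilon> p)"

lemma subexponential_onE:
  assumes "subexponential_on I g" "\<epsilon> > 0"
  obtains C where "C > 0" "\<And>p. p \<in> I \<times> half_plane \<Longrightarrow> \<bar>g p\<bar> \<le> C * exp_weight \<epsilon> p"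
proof -
  obtain C where C: "\<And>p. p \<in> I \<times> half_plane \<Longrightarrow> \<bar>g p\<bar> \<le> C * exp_weight \<epsilon> p"
    using assms unfolding subexponential_on_def by meson
  have "\<bar>g p\<bar> \<le> max C 1 * exp_weight \<epsilon> p" if "p \<in> I \<times> half_plane" for p
    using C[OF that] exp_weight_pos[of \<epsilon> p]
    by (smt (verit, best) mult_right_mono max.cobounded1)
  then show ?thesis by (intro that[of "max C 1"]) auto
qed

lemma subexponential_on_subset:
  "subexponential_on I g \<Longrightarrow> J \<subseteq> I \<Longrightarrow> subexponential_on J g"
  unfolding subexponential_on_def by (meson Sigma_mono order_refl subsetD)

lemma subexponential_on_bounded:
  assumes "\<And>p. p \<in> I \<times> half_plane \<Longrightarrow> \<bar>g p\<bar> \<le> C"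
  shows "subexponential_on I g"
  unfolding subexponential_on_def
proof (intro allI impI exI[of _ "\<bar>C\<bar>"] ballI)
  fix \<epsilon> :: real and p assume "\<epsilon> > 0" "p \<in> I \<times> half_plane"
  then have "1 \<le> exp_weight \<epsilon> p" by (intro exp_weight_ge_1) auto
  then have "\<bar>C\<bar> * 1 \<le> \<bar>C\<bar> * exp_weight \<epsilon> p" by (intro mult_left_mono) auto
  then show "\<bar>g p\<bar> \<le> \<bar>C\<bar> * exp_weight \<epsilon> p" using assms[OF \<open>p \<in> _\<close>] by auto
qed

lemma subexponential_on_add:
  assumes "subexponential_on I f" "subexponential_on I g"
  shows "subexponential_on I (\<lambda>p. f p + g p)"
  unfolding subexponential_on_def
proof (intro allI impI)
  fix \<epsilon> :: real assume e: "\<epsilon> > 0"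
  obtain C where C: "\<And>p. p \<in> I \<times> half_plane \<Longrightarrow> \<bar>f p\<bar> \<le> C * exp_weight \<epsilon> p"
    using subexponential_onE[OF assms(1) e] by metis
  obtain D where D: "\<And>p. p \<in> I \<times> half_plane \<Longrightarrow> \<bar>g p\<bar> \<le> D * exp_weight \<epsilon> p"
    using subexponential_onE[OF assms(2) e] by metis
  have "\<bar>f p + g p\<bar> \<le> (C + D) * exp_weight \<epsilon> p" if "p \<in> I \<times> half_plane" for p
    using C[OF that] D[OF that] by (auto simp: distrib_right)
  then show "\<exists>C. \<forall>p\<in>I \<times> half_plane. \<bar>f p + g p\<bar> \<le> C * exp_weight \<epsilon> p" by blast
qed

lemma subexponential_on_mult:
  assumes "subexponential_on I f" "subexponential_on I g"
  shows "subexponential_on I (\<lambda>p. f p * g p)"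
  unfolding subexponential_on_def
proof (intro allI impI)
  fix \<epsilon> :: real assume e: "\<epsilon> > 0"
  then have e2: "\<epsilon> / 2 > 0" by simp
  obtain C where C: "C > 0" "\<And>p. p \<in> I \<times> half_plane \<Longrightarrow> \<bar>f p\<bar> \<le> C * exp_weight (\<epsilon> / 2) p"
    using subexponential_onE[OF assms(1) e2] by metis
  obtain D where D: "D > 0" "\<And>p. p \<in> I \<times> half_plane \<Longrightarrow> \<bar>g p\<bar> \<le> D * exp_weight (\<epsilon> / 2) p"
    using subexponential_onE[OF assms(2) e2] by metis
  have "\<bar>f p * g p\<bar> \<le> (C * D) * exp_weight \<epsilon> p" if "p \<in> I \<times> half_plane" for p
  proof -
    have "\<bar>f p\<bar> * \<bar>g p\<bar> \<le> (C * exp_weight (\<epsilon> / 2) p) * (D * exp_weight (\<epsilon> / 2) p)"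
      using C D that exp_weight_pos[of "\<epsilon> / 2" p] by (intro mult_mono) auto
    then show ?thesis using exp_weight_add[of "\<epsilon> / 2" "\<epsilon> / 2" p]
      by (simp add: abs_mult algebra_simps)
  qed
  then show "\<exists>C. \<forall>p\<in>I \<times> half_plane. \<bar>f p * g p\<bar> \<le> C * exp_weight \<epsilon> p" by blast
qed

lemma subexponential_on_const: "subexponential_on I (\<lambda>p. r)"
  by (rule subexponential_on_bounded[of _ _ "\<bar>r\<bar>"]) auto

lemma subexponential_on_uminus:
  "subexponential_on I f \<Longrightarrow> subexponential_on I (\<lambda>p. - f p)"
  by (simp add: subexponential_on_def)

lemma subexponential_on_diff:
  "subexponential_on I f \<Longrightarrow> subexponential_on I g \<Longrightarrow> subexponential_on I (\<lambda>p. f p - g p)"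
  using subexponential_on_add[OF _ subexponential_on_uminus, of I f g] by simp

lemma subexponential_on_abs:
  "subexponential_on I f \<Longrightarrow> subexponential_on I (\<lambda>p. \<bar>f p\<bar>)"
  by (simp add: subexponential_on_def)

lemma subexponential_on_power:
  "subexponential_on I f \<Longrightarrow> subexponential_on I (\<lambda>p. f p ^ n)"
  by (induction n) (auto intro: subexponential_on_mult subexponential_on_const)

lemma subexponential_on_sum:
  "(\<And>i. i \<in> A \<Longrightarrow> subexponential_on I (f i)) \<Longrightarrow> subexponential_on I (\<lambda>p. \<Sum>i\<in>A. f i p)"
  by (induction A rule: infinite_finite_induct)
     (auto intro: subexponential_on_add subexponential_on_const)

lemma subexponential_on_radius:
  "subexponential_on I (\<lambda>p. \<bar>fst (snd p)\<bar> + snd (snd p))"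
  unfolding subexponential_on_def
proof (intro allI impI)
  fix \<epsilon> :: real assume e: "\<epsilon> > 0"
  have "\<bar>\<bar>fst (snd p)\<bar> + snd (snd p)\<bar> \<le> (1 / \<epsilon>) * exp_weight \<epsilon> p" if "p \<in> I \<times> half_plane" for p
  proof -
    have "t \<le> exp t" for t :: real using exp_ge_add_one_self[of t] by linarith
    from this[of "\<epsilon> * (\<bar>fst (snd p)\<bar> + snd (snd p))"] show ?thesis
      using e that unfolding exp_weight_def mem_half_plane by (simp add: field_simps)
  qed
  then show "\<exists>C. \<forall>p\<in>I \<times> half_plane. \<bar>\<bar>fst (snd p)\<bar> + snd (snd p)\<bar> \<le> C * exp_weight \<epsilon> p"
    by blast
qed

lemma subexponential_on_dominated:
  assumes "subexponential_on I g" "\<And>p. p \<in> I \<times> half_plane \<Longrightarrow> \<bar>f p\<bar> \<le> \<bar>g p\<bar>"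
  shows "subexponential_on I f"
  using assms unfolding subexponential_on_def by (meson order_trans)

lemma subexponential_on_coordinates:
  "subexponential_on I (\<lambda>p. fst (snd p))" "subexponential_on I (\<lambda>p. snd (snd p))"
  by (rule subexponential_on_dominated[OF subexponential_on_radius]; simp add: mem_half_plane)+

lemma subexponential_on_time: "subexponential_on {s1..T} (\<lambda>p. fst p - s1)"
  by (rule subexponential_on_bounded[of _ _ "\<bar>T - s1\<bar>"]) (auto simp: mem_half_plane)

lemma powr_le_exp:
  fixes L \<epsilon> :: real
  assumes "L > 0" "\<epsilon> > 0"
  obtains C where "C > 0" "\<And>r. 0 \<le> r \<Longrightarrow> r powr L \<le> C * exp (\<epsilon> * r)"
proof -
  \<comment> \<open>This is \<open>(L / \<epsilon>) powr L\<close>. The bound is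
    \<open>ln t \<le> t - 1\<close> at \<open>t = \<epsilon> / L * r\<close>, multiplied by
    \<open>L\<close>.\<close>
  define C where "C = exp (- L * ln (\<epsilon> / L))"
  have "r powr L \<le> C * exp (\<epsilon> * r)" if "0 \<le> r" for r
  proof (cases "r = 0")
    case True
    then show ?thesis using assms by (simp add: C_def)
  next
    case False
    then have r: "0 < r" using that by simp
    have "ln (\<epsilon> / L * r) = ln (\<epsilon> / L) + ln r"
      using assms r by (intro ln_mult_pos) auto
    moreover have "ln (\<epsilon> / L * r) \<le> \<epsilon> / L * r - 1"
      using assms r by (intro ln_le_minus_one) auto
    ultimately have "ln (\<epsilon> / L) + ln r \<le> \<epsilon> / L * r" by linarith
    then have "L * (ln (\<epsilon> / L) + ln r) \<le> L * (\<epsilon> / L * r)"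
      using assms r by (intro mult_left_mono) auto
    then have "L * ln r \<le> - L * ln (\<epsilon> / L) + \<epsilon> * r"
      using assms by (simp add: algebra_simps)
    then show ?thesis using r by (simp add: powr_def C_def flip: exp_add)
  qed
  then show ?thesis by (intro that[of C]) (auto simp: C_def)
qed

lemma polynomial_growth_on_imp_subexponential:
  assumes "polynomial_growth_on I g"
  shows "subexponential_on I g"
proof -
  obtain C L where C: "C > 0" "L > 0" and
    g: "\<And>t x y. t \<in> I \<Longrightarrow> (x, y) \<in> half_plane \<Longrightarrow> \<bar>g (t, x, y)\<bar> \<le> C * (1 + \<bar>x\<bar> powr L + y powr L)"
    using assms unfolding polynomial_growth_on_def by fastforce
  have "subexponential_on I (\<lambda>p. \<bar>fst (snd p)\<bar> powr L)" (is "subexponential_on I ?f")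
    and "subexponential_on I (\<lambda>p. snd (snd p) powr L)" (is "subexponential_on I ?g")
    unfolding subexponential_on_def
  proof (safe)
    fix \<epsilon> :: real assume e: "\<epsilon> > 0"
    obtain D where D: "D > 0" "\<And>r. 0 \<le> r \<Longrightarrow> r powr L \<le> D * exp (\<epsilon> * r)"
      using powr_le_exp[OF C(2) e] by metis
    have D2: "r powr L \<le> D * exp (\<epsilon> * r')" if "0 \<le> r" "r \<le> r'" for r r'
    proof -
      have "exp (\<epsilon> * r) \<le> exp (\<epsilon> * r')" using that e by simp
      then show ?thesis using D(2)[OF that(1)] D(1)
        by (meson less_imp_le mult_left_mono order_trans)
    qed
    show "\<exists>C. \<forall>p\<in>I \<times> half_plane. \<bar>\<bar>fst (snd p)\<bar> powr L\<bar> \<le> C * exp_weight \<epsilon> p"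
      unfolding exp_weight_def by (rule exI[of _ D]) (auto intro!: D2 simp: half_plane_def)
    show "\<exists>C. \<forall>p\<in>I \<times> half_plane. \<bar>snd (snd p) powr L\<bar> \<le> C * exp_weight \<epsilon> p"
      unfolding exp_weight_def by (rule exI[of _ D]) (auto intro!: D2 simp: half_plane_def)
  qed
  then have "subexponential_on I (\<lambda>p. C * (1 + \<bar>fst (snd p)\<bar> powr L + snd (snd p) powr L))"
    by (intro subexponential_on_mult subexponential_on_add subexponential_on_const)
  moreover have "\<bar>g p\<bar> \<le> \<bar>C * (1 + \<bar>fst (snd p)\<bar> powr L + snd (snd p) powr L)\<bar>"
    if "p \<in> I \<times> half_plane" for p
    using that g[of "fst p" "fst (snd p)" "snd (snd p)"] by (auto intro: order_trans[OF _ abs_ge_self])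
  ultimately show ?thesis by (rule subexponential_on_dominated)
qed

text \<open>One half of the exponent bounds \<open>g\<close> up to a constant, the other half
  absorbs the constant once the point is far enough out. This is what reduces the unbounded domain
  to compact boxes.\<close>

lemma subexponential_on_small_far_out:
  assumes "subexponential_on I g" "\<epsilon> > 0" "\<eta> > 0"
  obtains R where "R > 0" "\<And>p. p \<in> I \<times> half_plane \<Longrightarrow> R \<le> \<bar>fst (snd p)\<bar> + snd (snd p) \<Longrightarrow>
    \<bar>g p\<bar> \<le> \<eta> * exp_weight \<epsilon> p"
proof -
  obtain C where C: "C > 0" "\<And>p. p \<in> I \<times> half_plane \<Longrightarrow> \<bar>g p\<bar> \<le> C * exp_weight (\<epsilon> / 2) p"
    using subexponential_onE[OF assms(1), of "\<epsilon> / 2"] assms(2) by auto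
  \<comment> \<open>The radius at which \<open>exp_weight (\<epsilon> / 2)\<close> reaches
    \<open>C / \<eta>\<close>; the maximum with 1 makes it positive.\<close>
  define R where "R = max 1 (2 / \<epsilon> * ln (C / \<eta>))"
  have "\<bar>g p\<bar> \<le> \<eta> * exp_weight \<epsilon> p"
    if p: "p \<in> I \<times> half_plane" and R: "R \<le> \<bar>fst (snd p)\<bar> + snd (snd p)" for p
  proof -
    have "ln (C / \<eta>) \<le> \<epsilon> / 2 * (\<bar>fst (snd p)\<bar> + snd (snd p))"
      using R assms(2) by (simp add: R_def field_simps)
    then have "exp (ln (C / \<eta>)) \<le> exp_weight (\<epsilon> / 2) p" by (simp add: exp_weight_def)
    then have "C \<le> \<eta> * exp_weight (\<epsilon> / 2) p" using C(1) assms(3) by (simp add: field_simps)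
    then have "C * exp_weight (\<epsilon> / 2) p \<le> \<eta> * exp_weight (\<epsilon> / 2) p * exp_weight (\<epsilon> / 2) p"
      using exp_weight_pos[of "\<epsilon> / 2" p] by (intro mult_right_mono) auto
    then show ?thesis using C(2)[OF p] exp_weight_add[of "\<epsilon> / 2" "\<epsilon> / 2" p] by simp
  qed
  then show ?thesis by (intro that[of R]) (auto simp: R_def)
qed

section \<open>Polynomials in shifted time and space, and the functions they approximate\<close>

text \<open>Time is centred at the initial time \<open>s1\<close>, so that each time power can serve
  as the source in Duhamel's formula started from \<open>s1\<close>. Generation by monomials and
  sums lets linear statements be proved by induction.\<close>

inductive polynomial_about :: "real \<Rightarrow> (real \<times> real \<times> real \<Rightarrow> real) \<Rightarrow> bool" for s1 where
  monomial: "polynomial_about s1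
    (\<lambda>p. k * ((fst p - s1) ^ m * (fst (snd p) ^ i * snd (snd p) ^ j)))"
| add: "polynomial_about s1 P \<Longrightarrow> polynomial_about s1 Q \<Longrightarrow> polynomial_about s1 (\<lambda>p. P p + Q p)"

lemma polynomial_about_mult:
  assumes "polynomial_about s1 P" "polynomial_about s1 Q"
  shows "polynomial_about s1 (\<lambda>p. P p * Q p)"
  using assms(1)
proof induction
  case (monomial k m i j)
  show ?case using assms(2)
  proof induction
    case (monomial k' m' i' j')
    have "(\<lambda>p. k * ((fst p - s1) ^ m * (fst (snd p) ^ i * snd (snd p) ^ j)) *
        (k' * ((fst p - s1) ^ m' * (fst (snd p) ^ i' * snd (snd p) ^ j')))) =
      (\<lambda>p. (k * k') * ((fst p - s1) ^ (m + m') *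
        (fst (snd p) ^ (i + i') * snd (snd p) ^ (j + j'))))"
      by (simp only: power_add mult_ac)
    then show ?case by (simp only: polynomial_about.monomial)
  next
    case (add P Q)
    then show ?case by (simp add: distrib_left polynomial_about.add)
  qed
next
  case (add P Q)
  then show ?case by (simp add: distrib_right polynomial_about.add)
qed

lemma polynomial_about_const: "polynomial_about s1 (\<lambda>p. k)"
  using polynomial_about.monomial[of s1 k 0 0 0] by simp

lemma polynomial_about_coordinates:
  "polynomial_about s1 fst" "polynomial_about s1 (\<lambda>p. fst (snd p))"
  "polynomial_about s1 (\<lambda>p. snd (snd p))"
  using polynomial_about.add[OF polynomial_about.monomial[of s1 1 1 0 0] polynomial_about_const[of s1 s1]]
    polynomial_about.monomial[of s1 1 0 1 0] polynomial_about.monomial[of s1 1 0 0 1] by simp_all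

lemma polynomial_about_power: "polynomial_about s1 P \<Longrightarrow> polynomial_about s1 (\<lambda>p. P p ^ n)"
  by (induction n) (auto intro: polynomial_about_mult polynomial_about_const)

lemma polynomial_about_sum:
  "(\<And>i. i \<in> A \<Longrightarrow> polynomial_about s1 (P i)) \<Longrightarrow> polynomial_about s1 (\<lambda>p. \<Sum>i\<in>A. P i p)"
  by (induction A rule: infinite_finite_induct)
     (auto intro: polynomial_about.add polynomial_about_const)

lemma polynomial_about_subexponential:
  "polynomial_about s1 P \<Longrightarrow> subexponential_on {s1..T} P"
  by (induction rule: polynomial_about.induct)
     (auto intro!: subexponential_on_add subexponential_on_mult subexponential_on_const
       subexponential_on_power subexponential_on_time subexponential_on_coordinates)

text \<open>Requiring approximation only in the weights with exponent strictly above \<open>\<epsilon>\<close> is what makes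
  this class closed under products.\<close>

definition polynomially_approximable ::
  "real \<Rightarrow> real \<Rightarrow> real \<Rightarrow> (real \<times> real \<times> real \<Rightarrow> real) \<Rightarrow> bool" where
  "polynomially_approximable s1 T \<epsilon> g \<longleftrightarrow> subexponential_on {s1..T} g \<and>
     (\<forall>\<epsilon>'>\<epsilon>. \<forall>\<eta>>0. \<exists>P. polynomial_about s1 P \<and>
        (\<forall>p\<in>{s1..T} \<times> half_plane. \<bar>g p - P p\<bar> \<le> \<eta> * exp_weight \<epsilon>' p))"

lemma polynomially_approximableE:
  assumes "polynomially_approximable s1 T \<epsilon> g" "\<epsilon> < \<epsilon>'" "\<eta> > 0"
  obtains P where "polynomial_about s1 P"
    "\<And>p. p \<in> {s1..T} \<times> half_plane \<Longrightarrow> \<bar>g p - P p\<bar> \<le> \<eta> * exp_weight \<epsilon>' p"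
  using assms unfolding polynomially_approximable_def by metis

lemma polynomially_approximable_polynomial:
  assumes "polynomial_about s1 P"
  shows "polynomially_approximable s1 T \<epsilon> P"
  unfolding polynomially_approximable_def
  using assms polynomial_about_subexponential exp_weight_pos by (fastforce intro!: exI[of _ P] less_imp_le)

lemma polynomially_approximable_add:
  assumes "polynomially_approximable s1 T \<epsilon> f" "polynomially_approximable s1 T \<epsilon> g"
  shows "polynomially_approximable s1 T \<epsilon> (\<lambda>p. f p + g p)"
  unfolding polynomially_approximable_def
proof (intro conjI allI impI)
  show "subexponential_on {s1..T} (\<lambda>p. f p + g p)"
    using assms by (auto simp: polynomially_approximable_def intro: subexponential_on_add)
  fix \<epsilon>' \<eta> :: real assume e: "\<epsilon> < \<epsilon>'" "\<eta> > 0"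
  obtain P where P: "polynomial_about s1 P"
    "\<And>p. p \<in> {s1..T} \<times> half_plane \<Longrightarrow> \<bar>f p - P p\<bar> \<le> \<eta> / 2 * exp_weight \<epsilon>' p"
    using polynomially_approximableE[OF assms(1) e(1), of "\<eta> / 2"] e(2) by auto
  obtain Q where Q: "polynomial_about s1 Q"
    "\<And>p. p \<in> {s1..T} \<times> half_plane \<Longrightarrow> \<bar>g p - Q p\<bar> \<le> \<eta> / 2 * exp_weight \<epsilon>' p"
    using polynomially_approximableE[OF assms(2) e(1), of "\<eta> / 2"] e(2) by auto
  have "\<bar>f p + g p - (P p + Q p)\<bar> \<le> \<eta> * exp_weight \<epsilon>' p" if "p \<in> {s1..T} \<times> half_plane" for p
    using P(2)[OF that] Q(2)[OF that] by linarith
  then show "\<exists>P. polynomial_about s1 P \<and>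
      (\<forall>p\<in>{s1..T} \<times> half_plane. \<bar>f p + g p - P p\<bar> \<le> \<eta> * exp_weight \<epsilon>' p)"
    using polynomial_about.add[OF P(1) Q(1)] by blast
qed

lemma polynomially_approximable_mult:
  assumes f: "polynomially_approximable s1 T \<epsilon> f" and g: "polynomially_approximable s1 T \<epsilon> g"
  shows "polynomially_approximable s1 T \<epsilon> (\<lambda>p. f p * g p)"
  unfolding polynomially_approximable_def
proof (intro conjI allI impI)
  have fg: "subexponential_on {s1..T} f" "subexponential_on {s1..T} g"
    using assms by (auto simp: polynomially_approximable_def)
  then show "subexponential_on {s1..T} (\<lambda>p. f p * g p)" by (rule subexponential_on_mult)
  fix \<epsilon>' \<eta> :: real assume e: "\<epsilon> < \<epsilon>'" "\<eta> > 0"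
  \<comment> \<open>The excess of \<epsilon>' over \<epsilon> is halved: one \<gamma> pays for the
    growth of the factor that stays, the other keeps the exponent of the approximated factor
    strictly above \<epsilon>.\<close>
  define \<gamma> where "\<gamma> = (\<epsilon>' - \<epsilon>) / 2"
  have \<gamma>: "\<gamma> > 0" "\<epsilon> < \<epsilon> + \<gamma>" "\<epsilon>' = \<gamma> + (\<epsilon> + \<gamma>)" using e by (auto simp: \<gamma>_def field_simps)
  obtain C where C: "C > 0" "\<And>p. p \<in> {s1..T} \<times> half_plane \<Longrightarrow> \<bar>f p\<bar> \<le> C * exp_weight \<gamma> p"
    using subexponential_onE[OF fg(1) \<gamma>(1)] by metis
  obtain Q where Q: "polynomial_about s1 Q"
    "\<And>p. p \<in> {s1..T} \<times> half_plane \<Longrightarrow> \<bar>g p - Q p\<bar> \<le> \<eta> / (2 * C) * exp_weight (\<epsilon> + \<gamma>) p"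
    using polynomially_approximableE[OF g \<gamma>(2), of "\<eta> / (2 * C)"] e(2) C(1) by auto
  \<comment> \<open>\<open>Q\<close> is fixed before \<open>P\<close>, because the accuracy required
    of \<open>P\<close> depends on the growth constant of \<open>Q\<close>.\<close>
  obtain D where D: "D > 0" "\<And>p. p \<in> {s1..T} \<times> half_plane \<Longrightarrow> \<bar>Q p\<bar> \<le> D * exp_weight \<gamma> p"
    using subexponential_onE[OF polynomial_about_subexponential[OF Q(1)] \<gamma>(1)] by metis
  obtain P where P: "polynomial_about s1 P"
    "\<And>p. p \<in> {s1..T} \<times> half_plane \<Longrightarrow> \<bar>f p - P p\<bar> \<le> \<eta> / (2 * D) * exp_weight (\<epsilon> + \<gamma>) p"
    using polynomially_approximableE[OF f \<gamma>(2), of "\<eta> / (2 * D)"] e(2) D(1) by auto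
  have "\<bar>f p * g p - P p * Q p\<bar> \<le> \<eta> * exp_weight \<epsilon>' p" if p: "p \<in> {s1..T} \<times> half_plane" for p
  proof -
    have w: "exp_weight \<gamma> p > 0" "exp_weight (\<epsilon> + \<gamma>) p > 0" by (rule exp_weight_pos)+
    have "\<bar>f p\<bar> * \<bar>g p - Q p\<bar> \<le> (C * exp_weight \<gamma> p) * (\<eta> / (2 * C) * exp_weight (\<epsilon> + \<gamma>) p)"
      using C Q(2)[OF p] p w by (intro mult_mono) auto
    also have "\<dots> = \<eta> / 2 * exp_weight \<epsilon>' p"
      unfolding \<gamma>(3) exp_weight_add[of \<gamma> "\<epsilon> + \<gamma>"] using C(1) by (simp add: field_simps)
    finally have 1: "\<bar>f p * (g p - Q p)\<bar> \<le> \<eta> / 2 * exp_weight \<epsilon>' p" by (simp add: abs_mult)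
    have "\<bar>Q p\<bar> * \<bar>f p - P p\<bar> \<le> (D * exp_weight \<gamma> p) * (\<eta> / (2 * D) * exp_weight (\<epsilon> + \<gamma>) p)"
      using D P(2)[OF p] p w by (intro mult_mono) auto
    also have "\<dots> = \<eta> / 2 * exp_weight \<epsilon>' p"
      unfolding \<gamma>(3) exp_weight_add[of \<gamma> "\<epsilon> + \<gamma>"] using D(1) by (simp add: field_simps)
    finally have 2: "\<bar>Q p * (f p - P p)\<bar> \<le> \<eta> / 2 * exp_weight \<epsilon>' p" by (simp add: abs_mult)
    have "f p * g p - P p * Q p = f p * (g p - Q p) + Q p * (f p - P p)"
      by (simp add: algebra_simps)
    then show ?thesis using 1 2 by linarith
  qed
  then show "\<exists>P. polynomial_about s1 P \<and>
      (\<forall>p\<in>{s1..T} \<times> half_plane. \<bar>f p * g p - P p\<bar> \<le> \<eta> * exp_weight \<epsilon>' p)"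
    using polynomial_about_mult[OF P(1) Q(1)] by blast
qed

section \<open>Weighted approximation by folding the half plane with sines\<close>

text \<open>The Taylor remainder is \<open>(u / \<epsilon>) ^ n\<close> times
  \<open>(\<epsilon> * \<bar>r\<bar>) ^ n / fact n\<close>. The second factor is a single term of
  the exponential series, the first is at most \<open>(1 / 2) ^ n\<close>; so the Taylor polynomials
  converge on the whole line relative to the weight.\<close>

lemma sin_Taylor_weighted:
  fixes u \<epsilon> r :: real
  assumes "0 < u" "u \<le> \<epsilon> / 2"
  shows "\<bar>sin (u * r) - (\<Sum>m<n. sin_coeff m * (u * r) ^ m)\<bar> \<le> (1 / 2) ^ n * exp (\<epsilon> * \<bar>r\<bar>)"
proof -
  have e: "\<epsilon> > 0" using assms by simp
  have "\<bar>sin (u * r) - (\<Sum>m<n. sin_coeff m * (u * r) ^ m)\<bar> \<le> inverse (fact n) * \<bar>u * r\<bar> ^ n"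
    by (rule Maclaurin_sin_bound)
  also have "\<bar>u * r\<bar> = (u / \<epsilon>) * (\<epsilon> * \<bar>r\<bar>)"
    using assms e by (simp add: abs_mult)
  also have "inverse (fact n) * (u / \<epsilon> * (\<epsilon> * \<bar>r\<bar>)) ^ n = (u / \<epsilon>) ^ n * ((\<epsilon> * \<bar>r\<bar>) ^ n / fact n)"
    by (simp only: power_mult_distrib divide_inverse mult_ac)
  also have "\<dots> \<le> (1 / 2) ^ n * exp (\<epsilon> * \<bar>r\<bar>)"
  proof (intro mult_mono power_mono)
    have "(\<Sum>m<Suc n. (\<epsilon> * \<bar>r\<bar>) ^ m /\<^sub>R fact m) \<le> exp (\<epsilon> * \<bar>r\<bar>)"
      unfolding exp_def using e by (intro sum_le_suminf summable_exp_generic) auto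
    moreover have "(\<epsilon> * \<bar>r\<bar>) ^ n /\<^sub>R fact n \<le> (\<Sum>m<Suc n. (\<epsilon> * \<bar>r\<bar>) ^ m /\<^sub>R fact m)"
      using e by (intro member_le_sum) auto
    ultimately show "(\<epsilon> * \<bar>r\<bar>) ^ n / fact n \<le> exp (\<epsilon> * \<bar>r\<bar>)" by (simp add: field_simps)
  qed (use assms e in \<open>auto simp: field_simps\<close>)
  finally show ?thesis .
qed

lemma polynomially_approximable_sin:
  assumes z: "z = (\<lambda>p. fst (snd p)) \<or> z = (\<lambda>p. snd (snd p))" and u: "0 < u" "u \<le> \<epsilon> / 2"
  shows "polynomially_approximable s1 T \<epsilon> (\<lambda>p. sin (u * z p))"
  unfolding polynomially_approximable_def
proof (intro conjI allI impI)
  show "subexponential_on {s1..T} (\<lambda>p. sin (u * z p))"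
    by (rule subexponential_on_bounded[of _ _ 1]) auto
  fix \<epsilon>' \<eta> :: real assume e: "\<epsilon> < \<epsilon>'" "\<eta> > 0"
  obtain n where n: "(1 / 2 :: real) ^ n < \<eta>" using real_arch_pow_inv[OF e(2), of "1 / 2"] by auto
  define P where "P p = (\<Sum>m<n. sin_coeff m * (u * z p) ^ m)" for p
  have zp: "polynomial_about s1 z" using z polynomial_about_coordinates by auto
  have "polynomial_about s1 P"
    unfolding P_def by (intro polynomial_about_sum polynomial_about_mult polynomial_about_power
        polynomial_about_const zp)
  moreover have "\<bar>sin (u * z p) - P p\<bar> \<le> \<eta> * exp_weight \<epsilon>' p" if p: "p \<in> {s1..T} \<times> half_plane" for p
  proof -
    have "\<bar>z p\<bar> \<le> \<bar>fst (snd p)\<bar> + snd (snd p)" using z p by (auto simp: mem_half_plane)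
    then have "exp (\<epsilon> * \<bar>z p\<bar>) \<le> exp_weight \<epsilon> p"
      using u unfolding exp_weight_def by simp
    also have "\<dots> \<le> exp_weight \<epsilon>' p" using e p by (intro exp_weight_mono[OF _ p]) auto
    finally have "(1 / 2) ^ n * exp (\<epsilon> * \<bar>z p\<bar>) \<le> \<eta> * exp_weight \<epsilon>' p"
      using n by (intro mult_mono) (auto simp: less_imp_le e)
    then show ?thesis using sin_Taylor_weighted[OF u, of "z p" n] by (simp add: P_def)
  qed
  ultimately show "\<exists>P. polynomial_about s1 P \<and>
      (\<forall>p\<in>{s1..T} \<times> half_plane. \<bar>sin (u * z p) - P p\<bar> \<le> \<eta> * exp_weight \<epsilon>' p)" by blast
qed

text \<open>Ensures that folding a point by the sine and unfolding it again never moves it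
  outwards.\<close>

lemma abs_arcsin_sin_le: "\<bar>arcsin (sin t)\<bar> \<le> \<bar>t\<bar>"
proof (cases "\<bar>t\<bar> \<le> pi / 2")
  case True
  then show ?thesis by (simp add: arcsin_sin)
next
  case False
  then show ?thesis using arcsin_bounded[of "sin t"] by auto
qed

text \<open>The sine folds the half plane into a compact box, where Stone-Weierstrass applies to
  \<open>g\<close> composed with the unfolding. The resulting polynomial in time and sines is
  approximable by polynomials. Unfolding inverts folding near the origin; far out both
  \<open>g p\<close> and its value at the refolded point are negligible against the weight.\<close>

lemma weighted_polynomial_approximation:
  fixes g :: "real \<times> real \<times> real \<Rightarrow> real"
  assumes cont: "continuous_on ({s1..T} \<times> half_plane) g" and sub: "subexponential_on {s1..T} g"
    and pos: "\<epsilon> > 0" "\<eta> > 0"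
  obtains P where "polynomial_about s1 P"
    "\<And>p. p \<in> {s1..T} \<times> half_plane \<Longrightarrow> \<bar>g p - P p\<bar> \<le> \<eta> * exp_weight \<epsilon> p"
proof -
  obtain R where R: "R > 0" "\<And>p. p \<in> {s1..T} \<times> half_plane \<Longrightarrow>
      R \<le> \<bar>fst (snd p)\<bar> + snd (snd p) \<Longrightarrow> \<bar>g p\<bar> \<le> \<eta> / 6 * exp_weight \<epsilon> p"
    using subexponential_on_small_far_out[OF sub, of \<epsilon> "\<eta> / 6"] pos by auto
  obtain C where C: "C > 0" "\<And>p. p \<in> {s1..T} \<times> half_plane \<Longrightarrow> \<bar>g p\<bar> \<le> C * exp_weight (\<epsilon> / 2) p"
    using subexponential_onE[OF sub, of "\<epsilon> / 2"] pos by auto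
  \<comment> \<open>A far point may be folded back to anywhere no farther out, where only the bound
    with constant \<open>C\<close> and half the exponent is available. Beyond \<open>R'\<close> the
    other half, taken at the original point, absorbs \<open>C\<close>.\<close>
  obtain R' where R': "R' > 0" "\<And>p. p \<in> {s1..T} \<times> half_plane \<Longrightarrow>
      R' \<le> \<bar>fst (snd p)\<bar> + snd (snd p) \<Longrightarrow> \<bar>C\<bar> \<le> \<eta> / 6 * exp_weight (\<epsilon> / 2) p"
    using subexponential_on_small_far_out[OF subexponential_on_const, of "\<epsilon> / 2" "\<eta> / 6" "{s1..T}" C] pos
    by auto
  \<comment> \<open>The bound \<epsilon>/4 is what the sine approximation needs at exponent
    \<epsilon>/2; the other bound makes \<open>arcsin\<close> invert the sine up to radius
    \<open>max R R'\<close>.\<close>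
  define u where "u = min (\<epsilon> / 4) (pi / (2 * max R R'))"
  have u: "0 < u" "u \<le> \<epsilon> / 2 / 2" "u * max R R' \<le> pi / 2"
    using pos R(1) pi_gt_zero by (auto simp: u_def min_def field_simps)
  define box where "box = {s1..T} \<times> {-1..1::real} \<times> {-1..1::real}"
  \<comment> \<open>The third coordinate of a box point may be negative; \<open>max 0\<close> keeps
    the unfolded point in the half plane, where \<open>g\<close> is continuous.\<close>
  define unfold_pt where "unfold_pt q = (fst q, arcsin (fst (snd q)) / u, max 0 (arcsin (snd (snd q)) / u))"
    for q :: "real \<times> real \<times> real"
  define fold_pt where "fold_pt p = (fst p, sin (u * fst (snd p)), sin (u * snd (snd p)))"
    for p :: "real \<times> real \<times> real"
  have "continuous_on box unfold_pt"
    unfolding unfold_pt_def box_def using u(1) by (intro continuous_intros) auto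
  moreover have "unfold_pt ` box \<subseteq> {s1..T} \<times> half_plane"
    by (auto simp: box_def unfold_pt_def half_plane_def)
  ultimately have "continuous_on box (\<lambda>q. g (unfold_pt q))"
    using continuous_on_compose2[OF cont] by blast
  moreover have "compact box" unfolding box_def by (intro compact_Times compact_Icc)
  moreover have "0 < \<eta> / 6" using pos by simp
  ultimately obtain G where G: "real_polynomial_function G"
    "\<And>q. q \<in> box \<Longrightarrow> \<bar>g (unfold_pt q) - G q\<bar> < \<eta> / 6"
    using Stone_Weierstrass_real_polynomial_function[of box "\<lambda>q. g (unfold_pt q)" "\<eta> / 6"] by blast
  have fold_box: "fold_pt p \<in> box" if "p \<in> {s1..T} \<times> half_plane" for p
    using that by (auto simp: fold_pt_def box_def)
  have "polynomially_approximable s1 T (\<epsilon> / 2) (\<lambda>p. G (fold_pt p))" using G(1)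
  proof induction
    case (linear f)
    then interpret bounded_linear f .
    \<comment> \<open>A linear functional combines the three coordinates of the folded point: time,
      which is a polynomial, and two sines.\<close>
    have f_eq: "f q = fst q * f (1, 0, 0) + fst (snd q) * f (0, 1, 0) + snd (snd q) * f (0, 0, 1)" for q
    proof -
      have "q = fst q *\<^sub>R (1, 0, 0) + fst (snd q) *\<^sub>R (0, 1, 0) + snd (snd q) *\<^sub>R (0, 0, 1)"
        by (cases q) auto
      then show ?thesis by (metis add scaleR real_scaleR_def)
    qed
    have eq: "(\<lambda>p. f (fold_pt p)) = (\<lambda>p. fst p * f (1, 0, 0) + sin (u * fst (snd p)) * f (0, 1, 0)
        + sin (u * snd (snd p)) * f (0, 0, 1))"
      by (rule ext, subst f_eq) (simp add: fold_pt_def)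
    have "polynomially_approximable s1 T (\<epsilon> / 2) (\<lambda>p. sin (u * fst (snd p)))"
      "polynomially_approximable s1 T (\<epsilon> / 2) (\<lambda>p. sin (u * snd (snd p)))"
      by (rule polynomially_approximable_sin[OF _ u(1,2)]; simp)+
    moreover note polynomially_approximable_polynomial[OF polynomial_about_coordinates(1)]
      polynomially_approximable_polynomial[OF polynomial_about_const]
    ultimately show ?case
      unfolding eq by (intro polynomially_approximable_add polynomially_approximable_mult)
  next
    case (const r)
    show ?case by (rule polynomially_approximable_polynomial[OF polynomial_about_const])
  next
    case (add f g)
    show ?case using add.IH by (rule polynomially_approximable_add)
  next
    case (mult f g)
    show ?case using mult.IH by (rule polynomially_approximable_mult)
  qed
  then obtain P where P: "polynomial_about s1 P"
    "\<And>p. p \<in> {s1..T} \<times> half_plane \<Longrightarrow> \<bar>G (fold_pt p) - P p\<bar> \<le> \<eta> / 2 * exp_weight \<epsilon> p"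
    using polynomially_approximableE[of s1 T "\<epsilon> / 2" "\<lambda>p. G (fold_pt p)" \<epsilon> "\<eta> / 2"] pos by auto
  have "\<bar>g p - P p\<bar> \<le> \<eta> * exp_weight \<epsilon> p" if p: "p \<in> {s1..T} \<times> half_plane" for p
  proof -
    define p' where "p' = unfold_pt (fold_pt p)"
    have y: "snd (snd p) \<ge> 0" using p by (simp add: mem_half_plane)
    have p': "p' \<in> {s1..T} \<times> half_plane"
      using p by (auto simp: p'_def unfold_pt_def fold_pt_def half_plane_def)
    have "\<bar>g p - g p'\<bar> \<le> \<eta> / 3 * exp_weight \<epsilon> p"
    proof (cases "\<bar>fst (snd p)\<bar> + snd (snd p) \<le> max R R'")
      case True
      then have "\<bar>u * fst (snd p)\<bar> \<le> pi / 2" "u * snd (snd p) \<le> pi / 2"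
        using u(1) y order_trans[OF mult_left_mono u(3), of "\<bar>fst (snd p)\<bar>"]
          order_trans[OF mult_left_mono u(3), of "snd (snd p)"] by (auto simp: abs_mult)
      moreover have "0 \<le> u * snd (snd p)" using u(1) y by simp
      ultimately have "arcsin (sin (u * fst (snd p))) = u * fst (snd p)"
        "arcsin (sin (u * snd (snd p))) = u * snd (snd p)"
        using pi_gt_zero by (auto intro!: arcsin_sin)
      then have "p' = p"
        using u(1) y by (simp add: p'_def unfold_pt_def fold_pt_def prod_eq_iff)
      then show ?thesis using pos exp_weight_pos[of \<epsilon> p] by simp
    next
      case False
      have 1: "\<bar>g p\<bar> \<le> \<eta> / 6 * exp_weight \<epsilon> p" using False by (intro R(2)[OF p]) auto
      have "\<bar>arcsin (sin (u * r)) / u\<bar> \<le> \<bar>r\<bar>" for r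
        using abs_arcsin_sin_le[of "u * r"] u(1) by (simp add: abs_mult field_simps)
      from this[of "fst (snd p)"] this[of "snd (snd p)"]
      have "\<bar>fst (snd p')\<bar> + snd (snd p') \<le> \<bar>fst (snd p)\<bar> + snd (snd p)"
        using y by (simp add: p'_def unfold_pt_def fold_pt_def max_def abs_le_iff del: abs_divide) linarith
      then have le: "exp_weight (\<epsilon> / 2) p' \<le> exp_weight (\<epsilon> / 2) p"
        using pos by (simp add: exp_weight_def)
      have "\<bar>g p'\<bar> \<le> C * exp_weight (\<epsilon> / 2) p'" by (rule C(2)[OF p'])
      also have "\<dots> \<le> (\<eta> / 6 * exp_weight (\<epsilon> / 2) p) * exp_weight (\<epsilon> / 2) p"
        using R'(2)[OF p] False C(1) le exp_weight_pos[of "\<epsilon> / 2"] pos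
        by (intro mult_mono) (auto simp: less_imp_le)
      also have "\<dots> = \<eta> / 6 * exp_weight \<epsilon> p" using exp_weight_add[of "\<epsilon> / 2" "\<epsilon> / 2" p] by simp
      finally show ?thesis using 1 by linarith
    qed
    moreover have "\<bar>g p' - G (fold_pt p)\<bar> \<le> \<eta> / 6 * exp_weight \<epsilon> p"
    proof -
      have "\<eta> / 6 * 1 \<le> \<eta> / 6 * exp_weight \<epsilon> p"
        using pos exp_weight_ge_1[OF _ p] by (intro mult_left_mono) auto
      then show ?thesis using G(2)[OF fold_box[OF p]] by (simp add: p'_def)
    qed
    \<comment> \<open>The errors of folding, of Stone-Weierstrass and of the sine polynomials add up
      to \<eta>/3 + \<eta>/6 + \<eta>/2.\<close>
    ultimately show ?thesis using P(2)[OF p] by linarith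
  qed
  then show ?thesis using that P(1) by blast
qed

section \<open>Semicontinuous functions\<close>

lemma upper_semicontinuous_onE:
  assumes "upper_semicontinuous_on S g" "p \<in> S" "g p < r"
  obtains U where "open U" "p \<in> U" "\<And>q. q \<in> U \<Longrightarrow> q \<in> S \<Longrightarrow> g q < r"
proof -
  have "\<forall>\<^sub>F q in at p within S. g q < r" using assms by (auto simp: upper_semicontinuous_on_def)
  then obtain U where "open U" "p \<in> U" "\<And>q. q \<in> U \<Longrightarrow> q \<noteq> p \<Longrightarrow> q \<in> S \<Longrightarrow> g q < r"
    unfolding eventually_at_topological by blast
  \<comment> \<open>The filter \<open>at p\<close> leaves out \<open>p\<close>, where the bound is
    the assumption itself.\<close>
  then show ?thesis using that assms(3) by metis
qed

lemma lower_semicontinuous_on_uminus: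
  "lower_semicontinuous_on S g \<Longrightarrow> upper_semicontinuous_on S (\<lambda>p. - g p)"
  unfolding lower_semicontinuous_on_def upper_semicontinuous_on_def
proof (intro ballI allI impI)
  fix p r assume "\<forall>p\<in>S. \<forall>c<g p. \<forall>\<^sub>F q in at p within S. c < g q" "p \<in> S" "- g p < r"
  then have "\<forall>\<^sub>F q in at p within S. - r < g q" by simp
  then show "\<forall>\<^sub>F q in at p within S. - g q < r" by eventually_elim simp
qed

lemma lower_semicontinuous_on_subset:
  assumes "lower_semicontinuous_on S g" "S' \<subseteq> S"
  shows "lower_semicontinuous_on S' g"
  using assms unfolding lower_semicontinuous_on_def
  by (meson eventually_mono at_le filter_leD subsetD)

lemma upper_semicontinuous_on_subset:
  assumes "upper_semicontinuous_on S g" "S' \<subseteq> S"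
  shows "upper_semicontinuous_on S' g"
  using assms unfolding upper_semicontinuous_on_def
  by (meson eventually_mono at_le filter_leD subsetD)

lemma continuous_on_imp_upper_semicontinuous_on:
  fixes g :: "'a::topological_space \<Rightarrow> real"
  assumes "continuous_on S g"
  shows "upper_semicontinuous_on S g"
  using assms order_tendstoD(2) unfolding continuous_on_def upper_semicontinuous_on_def by blast

lemma upper_semicontinuous_on_add:
  assumes "upper_semicontinuous_on S f" "upper_semicontinuous_on S g"
  shows "upper_semicontinuous_on S (\<lambda>p. f p + g p)"
  unfolding upper_semicontinuous_on_def
proof (intro ballI allI impI)
  fix p r assume p: "p \<in> S" and less: "f p + g p < r"
  define \<delta> where "\<delta> = (r - (f p + g p)) / 2"
  have "\<delta> > 0" using less by (simp add: \<delta>_def)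
  then have "\<forall>\<^sub>F q in at p within S. f q < f p + \<delta>" "\<forall>\<^sub>F q in at p within S. g q < g p + \<delta>"
    using assms p unfolding upper_semicontinuous_on_def by auto
  then show "\<forall>\<^sub>F q in at p within S. f q + g q < r"
    by eventually_elim (simp add: \<delta>_def field_simps)
qed

lemma upper_semicontinuous_on_diff:
  assumes "upper_semicontinuous_on S f" "lower_semicontinuous_on S g"
  shows "upper_semicontinuous_on S (\<lambda>p. f p - g p)"
  using upper_semicontinuous_on_add[OF assms(1) lower_semicontinuous_on_uminus[OF assms(2)]] by simp

lemma upper_semicontinuous_on_less_continuous:
  fixes w k :: "'a::topological_space \<Rightarrow> real"
  assumes "upper_semicontinuous_on S w" "continuous_on S k" "p \<in> S" "w p < k p"
  shows "\<forall>\<^sub>F q in at p within S. w q < k q"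
proof -
  have "upper_semicontinuous_on S (\<lambda>q. w q + - k q)"
    by (rule upper_semicontinuous_on_add[OF assms(1)
          continuous_on_imp_upper_semicontinuous_on[OF continuous_on_minus[OF assms(2)]]])
  then have "\<forall>\<^sub>F q in at p within S. w q + - k q < 0"
    unfolding upper_semicontinuous_on_def using assms(3,4) by (metis add.commute diff_less_0_iff_less
      uminus_add_conv_diff)
  then show ?thesis by eventually_elim simp
qed

section \<open>Maxima and insertion of continuous functions on compact sets\<close>

text \<open>If every \<open>x\<close> had a strictly better \<open>Y x\<close>, compactness would
  leave finitely many neighbourhoods on which \<open>f\<close> stays below \<open>f (Y x)\<close>.
  For the \<open>x\<close> among them with \<open>f (Y x)\<close> largest, \<open>Y x\<close> lies
  in one of these neighbourhoods, which is absurd.\<close>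

lemma upper_semicontinuous_on_attains_max:
  fixes f :: "'a::topological_space \<Rightarrow> real"
  assumes usc: "upper_semicontinuous_on S f" and S: "compact S" "S \<noteq> {}"
  obtains x where "x \<in> S" "\<And>y. y \<in> S \<Longrightarrow> f y \<le> f x"
proof (rule ccontr)
  assume "\<not> thesis"
  then have "\<forall>x\<in>S. \<exists>y\<in>S. f x < f y" using that by (meson not_le)
  then obtain Y where Y: "\<And>x. x \<in> S \<Longrightarrow> Y x \<in> S" "\<And>x. x \<in> S \<Longrightarrow> f x < f (Y x)" by metis
  have "\<exists>U. open U \<and> x \<in> U \<and> (\<forall>q\<in>U \<inter> S. f q < f (Y x))" if "x \<in> S" for x
    using upper_semicontinuous_onE[OF usc that Y(2)[OF that]] by (metis IntD1 IntD2)
  then obtain U where U: "\<And>x. x \<in> S \<Longrightarrow> open (U x)" "\<And>x. x \<in> S \<Longrightarrow> x \<in> U x"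
    "\<And>x q. x \<in> S \<Longrightarrow> q \<in> U x \<Longrightarrow> q \<in> S \<Longrightarrow> f q < f (Y x)" by (metis IntI)
  obtain C where C: "C \<subseteq> S" "finite C" "S \<subseteq> (\<Union>x\<in>C. U x)"
    using compactE_image[OF S(1), of S U] U by (metis UN_iff subsetI)
  then have "C \<noteq> {}" using S(2) by auto
  with C(2) obtain x where "x \<in> C" "(MAX x\<in>C. f (Y x)) = f (Y x)" by (rule obtains_MAX)
  then have x: "x \<in> C" "\<And>x'. x' \<in> C \<Longrightarrow> f (Y x') \<le> f (Y x)"
    using C(2) Max_ge[of "(\<lambda>x. f (Y x)) ` C"] by auto
  obtain x' where "x' \<in> C" "Y x \<in> U x'" using C(1,3) Y(1) x(1) by blast
  then show False using U(3) x Y(1) C(1) by (meson not_le subsetD)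
qed

text \<open>Strictness allows a constant between \<open>w\<close> and \<open>v\<close> near each
  point; finitely many such constants are glued by a partition of unity, and convex combinations
  stay between.\<close>

lemma compact_insertion:
  fixes w v :: "'a::metric_space \<Rightarrow> real"
  assumes K: "compact K" and w: "upper_semicontinuous_on K w"
    and v: "upper_semicontinuous_on K (\<lambda>p. - v p)" and less: "\<And>p. p \<in> K \<Longrightarrow> w p < v p"
  obtains g where "continuous_on K g" "\<And>p. p \<in> K \<Longrightarrow> w p \<le> g p \<and> g p \<le> v p"
proof -
  have "\<exists>U. open U \<and> p \<in> U \<and> (\<exists>r. \<forall>q\<in>U \<inter> K. w q < r \<and> r < v q)" if p: "p \<in> K" for p
  proof -
    define r where "r = (w p + v p) / 2"
    have r: "w p < r" "- v p < - r" using less[OF that] by (auto simp: r_def)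
    obtain U where U: "open U" "p \<in> U" "\<And>q. q \<in> U \<Longrightarrow> q \<in> K \<Longrightarrow> w q < r"
      using upper_semicontinuous_onE[OF w p r(1)] by blast
    obtain V where "open V" "p \<in> V" "\<And>q. q \<in> V \<Longrightarrow> q \<in> K \<Longrightarrow> - v q < - r"
      using upper_semicontinuous_onE[OF v p r(2)] by blast
    with U have "open (U \<inter> V)" "p \<in> U \<inter> V" "\<forall>q\<in>U \<inter> V \<inter> K. w q < r \<and> r < v q" by auto
    then show ?thesis by blast
  qed
  then obtain U where U: "\<And>p. p \<in> K \<Longrightarrow> open (U p)" "\<And>p. p \<in> K \<Longrightarrow> p \<in> U p"
    "\<And>p. p \<in> K \<Longrightarrow> \<exists>r. \<forall>q\<in>U p \<inter> K. w q < r \<and> r < v q" by metis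
  obtain C where C: "C \<subseteq> K" "finite C" "K \<subseteq> (\<Union>p\<in>C. U p)"
    using compactE_image[OF K, of K U] U(1,2) by (metis UN_iff subsetI)
  define \<C> where "\<C> = U ` C"
  have fin: "finite \<C>" using C(2) by (simp add: \<C>_def)
  have "\<exists>r. \<forall>q\<in>V \<inter> K. w q < r \<and> r < v q" if "V \<in> \<C>" for V
    using that U(3) C(1) by (auto simp: \<C>_def)
  then obtain r where r: "\<And>V q. V \<in> \<C> \<Longrightarrow> q \<in> V \<Longrightarrow> q \<in> K \<Longrightarrow> w q < r V \<and> r V < v q"
    by (metis IntI)
  have cover: "K \<subseteq> \<Union>\<C>" "\<And>V. V \<in> \<C> \<Longrightarrow> open V" using C U(1) by (auto simp: \<C>_def)
  have locally_fin: "\<exists>V. open V \<and> x \<in> V \<and> finite {U \<in> \<C>. U \<inter> V \<noteq> {}}" for x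
    using fin by (intro exI[of _ UNIV]) auto
  obtain F :: "'a set \<Rightarrow> 'a \<Rightarrow> real"
    where F: "\<And>V. V \<in> \<C> \<Longrightarrow> continuous_on K (F V) \<and> (\<forall>x\<in>K. 0 \<le> F V x)"
      "\<And>x V. V \<in> \<C> \<Longrightarrow> x \<in> K \<Longrightarrow> x \<notin> V \<Longrightarrow> F V x = 0"
      "\<And>x. x \<in> K \<Longrightarrow> supp_sum (\<lambda>V. F V x) \<C> = 1"
  proof (rule subordinate_partition_of_unity[OF cover locally_fin], goal_cases)
    case (2 F)
    show ?case by (rule that[of F]) (fact 2)+
  qed
  have sum1: "(\<Sum>V\<in>\<C>. F V x) = 1" if "x \<in> K" for x
    using F(3)[OF that] fin unfolding supp_sum_def support_on_def
    by (subst sum.mono_neutral_right[where S = "{V \<in> \<C>. F V x \<noteq> 0}"]) auto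
  define g where "g x = (\<Sum>V\<in>\<C>. F V x * r V)" for x
  have "continuous_on K g" unfolding g_def using F(1) by (intro continuous_intros) auto
  moreover have "w x \<le> g x \<and> g x \<le> v x" if x: "x \<in> K" for x
  proof
    have "w x = (\<Sum>V\<in>\<C>. F V x * w x)" using sum1[OF x] by (simp flip: sum_distrib_right)
    also have "\<dots> \<le> g x" unfolding g_def
    proof (rule sum_mono)
      fix V assume V: "V \<in> \<C>"
      show "F V x * w x \<le> F V x * r V"
        using F(1)[OF V] F(2)[OF V x] r[OF V _ x] x by (cases "x \<in> V") (auto intro: mult_left_mono)
    qed
    finally show "w x \<le> g x" .
    have "g x \<le> (\<Sum>V\<in>\<C>. F V x * v x)" unfolding g_def
    proof (rule sum_mono)
      fix V assume V: "V \<in> \<C>"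
      show "F V x * r V \<le> F V x * v x"
        using F(1)[OF V] F(2)[OF V x] r[OF V _ x] x by (cases "x \<in> V") (auto intro: mult_left_mono)
    qed
    also have "\<dots> = v x" using sum1[OF x] by (simp flip: sum_distrib_right)
    finally show "g x \<le> v x" .
  qed
  ultimately show ?thesis using that by blast
qed

text \<open>Supplies the initial value for the smooth approximate solution. The insertion is done on
  a compact box of the slice and extended by composing with the projection onto that box, which
  keeps it bounded; far out everything disappears in the weight.\<close>

lemma initial_insertion:
  fixes w v :: "real \<times> real \<times> real \<Rightarrow> real"
  assumes "s1 \<le> T"
    and w: "upper_semicontinuous_on ({s1..T} \<times> half_plane) w" "subexponential_on {s1..T} w"
    and v: "lower_semicontinuous_on ({s1..T} \<times> half_plane) v" "subexponential_on {s1..T} v"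
    and le: "\<And>z. z \<in> half_plane \<Longrightarrow> w (s1, z) < v (s1, z) + \<eta> * exp_weight \<epsilon> (s1, z)"
    and pos: "\<epsilon> > 0" "\<eta> > 0"
  obtains g where "continuous_on ({s1..T} \<times> half_plane) g" "subexponential_on {s1..T} g"
    "\<And>z. z \<in> half_plane \<Longrightarrow> w (s1, z) \<le> g (s1, z) + 4 * \<eta> * exp_weight \<epsilon> (s1, z)"
    "\<And>z. z \<in> half_plane \<Longrightarrow> g (s1, z) \<le> v (s1, z) + 4 * \<eta> * exp_weight \<epsilon> (s1, z)"
proof -
  define m where "m p = \<bar>w p\<bar> + \<bar>v p\<bar>" for p
  have m: "subexponential_on {s1..T} m"
    unfolding m_def by (intro subexponential_on_add subexponential_on_abs w v)
  obtain C where C: "C > 0" "\<And>p. p \<in> {s1..T} \<times> half_plane \<Longrightarrow> \<bar>m p\<bar> \<le> C * exp_weight (\<epsilon> / 2) p"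
    using subexponential_onE[OF m, of "\<epsilon> / 2"] pos by auto
  obtain R where R: "R > 0" "\<And>p. p \<in> {s1..T} \<times> half_plane \<Longrightarrow>
      R \<le> \<bar>fst (snd p)\<bar> + snd (snd p) \<Longrightarrow> \<bar>C\<bar> \<le> \<eta> * exp_weight (\<epsilon> / 2) p"
    using subexponential_on_small_far_out[OF subexponential_on_const, of "\<epsilon> / 2" \<eta> "{s1..T}" C] pos
    by auto
  define K where "K = {s1} \<times> {-R..R} \<times> {0..R}"
  have K: "compact K" unfolding K_def by (intro compact_Times compact_Icc compact_insert compact_empty)
  have KD: "K \<subseteq> {s1..T} \<times> half_plane" using \<open>s1 \<le> T\<close> by (auto simp: K_def half_plane_def)
  have v': "upper_semicontinuous_on K (\<lambda>p. - (v p + \<eta> * exp_weight \<epsilon> p))"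
  proof -
    have "upper_semicontinuous_on K (\<lambda>p. - v p + - (\<eta> * exp_weight \<epsilon> p))"
      by (rule upper_semicontinuous_on_add[OF
            upper_semicontinuous_on_subset[OF lower_semicontinuous_on_uminus[OF v(1)] KD]])
         (intro continuous_on_imp_upper_semicontinuous_on continuous_intros)
    then show ?thesis by simp
  qed
  have "w p < v p + \<eta> * exp_weight \<epsilon> p" if "p \<in> K" for p
    using that le[of "snd p"] by (auto simp: K_def half_plane_def)
  then obtain g0 where g0: "continuous_on K g0"
    "\<And>p. p \<in> K \<Longrightarrow> w p \<le> g0 p \<and> g0 p \<le> v p + \<eta> * exp_weight \<epsilon> p"
    using compact_insertion[OF K upper_semicontinuous_on_subset[OF w(1) KD] v'] by metis
  \<comment> \<open>Clamps the space coordinates and sets the time to \<open>s1\<close>, so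
    \<open>g\<close> is constant in time and defined on the whole strip.\<close>
  define cl where "cl p = (s1, max (- R) (min R (fst (snd p))), max 0 (min R (snd (snd p))))"
    for p :: "real \<times> real \<times> real"
  define g where "g p = g0 (cl p)" for p
  have cl: "cl p \<in> K" for p using R(1) by (auto simp: cl_def K_def)
  have cont_cl: "continuous_on UNIV cl" unfolding cl_def by (intro continuous_intros)
  have "continuous_on UNIV g" unfolding g_def
    by (rule continuous_on_compose2[OF g0(1) cont_cl]) (use cl in blast)
  then have 1: "continuous_on ({s1..T} \<times> half_plane) g" by (rule continuous_on_subset) auto
  have "compact (g0 ` K)" by (rule compact_continuous_image[OF g0(1) K])
  then obtain B where B: "\<And>p. p \<in> K \<Longrightarrow> \<bar>g0 p\<bar> \<le> B"
    using compact_imp_bounded[of "g0 ` K"] unfolding bounded_iff by auto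
  have 2: "subexponential_on {s1..T} g"
    by (rule subexponential_on_bounded[of _ _ B]) (simp add: g_def B cl)
  have "w (s1, z) \<le> g (s1, z) + 4 * \<eta> * exp_weight \<epsilon> (s1, z) \<and>
    g (s1, z) \<le> v (s1, z) + 4 * \<eta> * exp_weight \<epsilon> (s1, z)" if z: "z \<in> half_plane" for z
  proof (cases "(s1, z) \<in> K")
    case True
    then have "cl (s1, z) = (s1, z)" by (cases z) (auto simp: cl_def K_def)
    moreover have "0 \<le> \<eta> * exp_weight \<epsilon> (s1, z)" using pos exp_weight_pos[of \<epsilon> "(s1, z)"] by simp
    ultimately show ?thesis using g0(2)[OF True] by (auto simp: g_def)
  next
    case False
    define p where "p = (s1, z)"
    have p: "p \<in> {s1..T} \<times> half_plane" using z \<open>s1 \<le> T\<close> by (auto simp: p_def)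
    have far: "R \<le> \<bar>fst (snd p)\<bar> + snd (snd p)"
      using False z by (cases z) (auto simp: K_def p_def half_plane_def)
    have bound: "\<bar>m q\<bar> \<le> \<eta> * exp_weight \<epsilon> p"
      if q: "q \<in> {s1..T} \<times> half_plane" "exp_weight (\<epsilon> / 2) q \<le> exp_weight (\<epsilon> / 2) p" for q
    proof -
      have "\<bar>m q\<bar> \<le> C * exp_weight (\<epsilon> / 2) q" by (rule C(2)[OF q(1)])
      also have "\<dots> \<le> (\<eta> * exp_weight (\<epsilon> / 2) p) * exp_weight (\<epsilon> / 2) p"
        using R(2)[OF p far] C(1) q(2) exp_weight_pos[of "\<epsilon> / 2"] pos
        by (intro mult_mono) (auto simp: less_imp_le)
      finally show ?thesis using exp_weight_add[of "\<epsilon> / 2" "\<epsilon> / 2" p] by simp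
    qed
    have le: "\<bar>fst (snd (cl p))\<bar> + snd (snd (cl p)) \<le> \<bar>fst (snd p)\<bar> + snd (snd p)"
      using p R(1) by (auto simp: cl_def mem_half_plane min_def max_def)
    have "exp_weight \<epsilon> (cl p) \<le> exp_weight \<epsilon> p"
      and cl2: "exp_weight (\<epsilon> / 2) (cl p) \<le> exp_weight (\<epsilon> / 2) p"
      using le pos by (auto simp: exp_weight_def)
    then have cl1: "\<eta> * exp_weight \<epsilon> (cl p) \<le> \<eta> * exp_weight \<epsilon> p" using pos by simp
    \<comment> \<open>At \<open>p\<close> and at its projection \<open>w\<close> and
      \<open>v\<close> are within \<eta> times the weight at \<open>p\<close> of zero, and the
      insertion allows one more such term above \<open>v\<close>; at most three are needed, so the
      factor 4 suffices.\<close>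
    show ?thesis
      using bound[OF p order_refl] bound[OF _ cl2] cl[of p] KD g0(2)[OF cl[of p]] cl1
      unfolding p_def[symmetric] g_def m_def by (auto simp: abs_le_iff subset_eq)
  qed
  then show ?thesis using that[OF 1 2] by blast
qed

text \<open>By contradiction: the violating points at times tending to 0 stay in a compact box,
  because \<open>w - v\<close> is small against the weight far out. At a limit point upper
  semicontinuity of \<open>w - v\<close> contradicts the order at time 0.\<close>

lemma initial_layer:
  fixes w v :: "real \<times> real \<times> real \<Rightarrow> real"
  assumes w: "upper_semicontinuous_on ({0..T} \<times> half_plane) w" "subexponential_on {0..T} w"
    and v: "lower_semicontinuous_on ({0..T} \<times> half_plane) v" "subexponential_on {0..T} v"
    and le: "\<And>z. z \<in> half_plane \<Longrightarrow> w (0, z) \<le> v (0, z)"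
    and pos: "\<epsilon> > 0" "\<eta> > 0" and s0: "0 < s0" "s0 \<le> T"
  shows "\<exists>s1>0. s1 < s0 \<and>
    (\<forall>z\<in>half_plane. w (s1, z) < v (s1, z) + \<eta> * exp_weight \<epsilon> (s1, z))"
proof (rule ccontr)
  assume nothesis: "\<not> ?thesis"
  have bad: "\<exists>z\<in>half_plane. v (s1, z) + \<eta> * exp_weight \<epsilon> (s1, z) \<le> w (s1, z)"
    if "0 < s1" "s1 < s0" for s1
    using nothesis that by (meson not_le)
  define D where "D p = w p - v p" for p
  have D: "upper_semicontinuous_on ({0..T} \<times> half_plane) D" "subexponential_on {0..T} D"
    unfolding D_def using w v by (auto intro: upper_semicontinuous_on_diff subexponential_on_diff)
  \<comment> \<open>The denominator starts at 2, so that all these times lie strictly between 0 and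
    \<open>s0\<close>.\<close>
  define t where "t n = s0 / real (n + 2)" for n
  have t: "0 < t n" "t n < s0" for n
    using s0(1) by (auto simp: t_def field_simps intro: add_pos_nonneg)
  obtain R where R: "R > 0" "\<And>p. p \<in> {0..T} \<times> half_plane \<Longrightarrow>
      R \<le> \<bar>fst (snd p)\<bar> + snd (snd p) \<Longrightarrow> \<bar>D p\<bar> \<le> \<eta> / 2 * exp_weight \<epsilon> p"
    using subexponential_on_small_far_out[OF D(2), of \<epsilon> "\<eta> / 2"] pos by auto
  obtain zs where zs: "\<And>n. zs n \<in> half_plane"
    "\<And>n. \<eta> * exp_weight \<epsilon> (t n, zs n) \<le> D (t n, zs n)"
    using bad[OF t] unfolding D_def by (metis add.commute le_diff_eq)
  have zsK: "zs n \<in> {-R..R} \<times> {0..R}" for n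
  proof (rule ccontr)
    assume "zs n \<notin> {-R..R} \<times> {0..R}"
    then have "\<bar>D (t n, zs n)\<bar> \<le> \<eta> / 2 * exp_weight \<epsilon> (t n, zs n)"
      using zs(1)[of n] t[of n] s0 by (intro R(2)) (auto simp: half_plane_def mem_Times_iff)
    moreover have "0 < \<eta> * exp_weight \<epsilon> (t n, zs n)" using pos exp_weight_pos by simp
    ultimately show False using zs(2)[of n] by linarith
  qed
  have "compact ({-R..R} \<times> {0..R})" by (intro compact_Times compact_Icc)
  then obtain z r where z: "z \<in> {-R..R} \<times> {0..R}" and r: "strict_mono r" "(zs \<circ> r) \<longlonglongrightarrow> z"
    using zsK unfolding compact_def by metis
  have "z \<in> half_plane" using z by (auto simp: half_plane_def)
  then have p: "(0, z) \<in> {0..T} \<times> half_plane" using s0 by auto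
  have "t \<longlonglongrightarrow> 0" unfolding t_def
    by (rule real_tendsto_divide_at_top[OF tendsto_const])
       (intro filterlim_compose[OF filterlim_real_sequentially] filterlim_add_const_nat_at_top)
  then have "(\<lambda>n. (t (r n), zs (r n))) \<longlonglongrightarrow> (0, z)"
    using LIMSEQ_subseq_LIMSEQ[OF _ r(1)] r(2) by (intro tendsto_Pair) (auto simp: o_def)
  then have lim: "filterlim (\<lambda>n. (t (r n), zs (r n))) (at (0, z) within {0..T} \<times> half_plane) sequentially"
  proof -
    \<comment> \<open>Convergence in the punctured filter requires avoiding the limit point; this
      holds because the times are positive.\<close>
    have "(t (r n), zs (r n)) \<in> {0..T} \<times> half_plane" "(t (r n), zs (r n)) \<noteq> (0, z)" for n
      using t[of "r n"] zs(1)[of "r n"] s0 by auto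
    then show ?thesis using \<open>_ \<longlonglongrightarrow> (0, z)\<close> by (simp add: filterlim_at)
  qed
  have "D (0, z) < \<eta> * exp_weight \<epsilon> (0, z)"
    using le[OF \<open>z \<in> half_plane\<close>] pos exp_weight_pos[of \<epsilon> "(0, z)"]
    by (simp add: D_def) (smt (verit) mult_pos_pos)
  then have "\<forall>\<^sub>F q in at (0, z) within {0..T} \<times> half_plane. D q < \<eta> * exp_weight \<epsilon> q"
    by (intro upper_semicontinuous_on_less_continuous[OF D(1) _ p]) (intro continuous_intros)
  then have "\<forall>\<^sub>F n in sequentially. D (t (r n), zs (r n)) < \<eta> * exp_weight \<epsilon> (t (r n), zs (r n))"
    using lim by (rule eventually_compose_filterlim)
  then show False using zs(2) unfolding eventually_sequentially by (metis not_le order_refl)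
qed

text \<open>\<open>M\<close> is the maximum of the quotient \<open>(w - u) / \<psi>\<close>. The
  quotient is at most \<eta> outside a compact box and exceeds \<eta> at \<open>q\<close>, so upper
  semicontinuity gives a maximum in the box; the initial bound keeps the maximizer off the slice at
  \<open>s1\<close>.\<close>

lemma first_touching_multiple:
  fixes w u \<psi> :: "real \<times> real \<times> real \<Rightarrow> real"
  assumes usc: "upper_semicontinuous_on ({s1..T} \<times> half_plane) w"
    and cont: "continuous_on UNIV u" "continuous_on UNIV \<psi>"
    and sub: "subexponential_on {s1..T} w" "subexponential_on {s1..T} u"
    and \<psi>: "\<And>p. p \<in> {s1..T} \<times> half_plane \<Longrightarrow> exp_weight \<epsilon> p \<le> \<psi> p"
    and pos: "\<epsilon> > 0" "\<eta> > 0"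
    and init: "\<And>z. z \<in> half_plane \<Longrightarrow> w (s1, z) \<le> u (s1, z) + \<eta> * \<psi> (s1, z)"
    and q: "q \<in> {s1..T} \<times> half_plane" "u q + \<eta> * \<psi> q < w q"
  obtains M p where "\<eta> < M" "p \<in> {s1<..T} \<times> half_plane" "w p = u p + M * \<psi> p"
    "\<And>q. q \<in> {s1..T} \<times> half_plane \<Longrightarrow> w q \<le> u q + M * \<psi> q"
proof -
  have \<psi>_pos: "0 < \<psi> p" if "p \<in> {s1..T} \<times> half_plane" for p
    using \<psi>[OF that] exp_weight_pos[of \<epsilon> p] by linarith
  obtain R where R: "R > 0" "\<And>p. p \<in> {s1..T} \<times> half_plane \<Longrightarrow>
      R \<le> \<bar>fst (snd p)\<bar> + snd (snd p) \<Longrightarrow> \<bar>w p - u p\<bar> \<le> \<eta> * exp_weight \<epsilon> p"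
    using subexponential_on_small_far_out[OF subexponential_on_diff[OF sub] pos] by metis
  define K where "K = {s1..T} \<times> {-R..R} \<times> {0..R}"
  have K: "compact K" unfolding K_def by (intro compact_Times compact_Icc)
  have KD: "K \<subseteq> {s1..T} \<times> half_plane" by (auto simp: K_def half_plane_def)
  have far: "w p \<le> u p + \<eta> * \<psi> p" if p: "p \<in> {s1..T} \<times> half_plane" "p \<notin> K" for p
  proof -
    have "R \<le> \<bar>fst (snd p)\<bar> + snd (snd p)"
      using p by (cases p) (auto simp: K_def half_plane_def)
    then have "\<bar>w p - u p\<bar> \<le> \<eta> * exp_weight \<epsilon> p" by (rule R(2)[OF p(1)])
    also have "\<dots> \<le> \<eta> * \<psi> p" using \<psi>[OF p(1)] pos by simp
    finally show ?thesis by linarith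
  qed
  define ratio where "ratio p = (w p - u p) / \<psi> p" for p
  have ratio: "ratio p < r \<longleftrightarrow> w p < u p + r * \<psi> p" if "p \<in> {s1..T} \<times> half_plane" for p r
    using \<psi>_pos[OF that] by (simp add: ratio_def field_simps)
  have "upper_semicontinuous_on K ratio"
    unfolding upper_semicontinuous_on_def
  proof (intro ballI allI impI)
    fix p r assume p: "p \<in> K" and "ratio p < r"
    then have "w p < u p + r * \<psi> p" using ratio KD by blast
    then have "\<forall>\<^sub>F q in at p within K. w q < u q + r * \<psi> q"
      using continuous_on_subset[OF cont(1)] continuous_on_subset[OF cont(2)]
      by (intro upper_semicontinuous_on_less_continuous[OF upper_semicontinuous_on_subset[OF usc KD] _ p])
         (auto intro!: continuous_intros)
    then have "\<forall>\<^sub>F q in at p within K. q \<in> K \<longrightarrow> ratio q < r"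
      by eventually_elim (use ratio KD in blast)
    then show "\<forall>\<^sub>F q in at p within K. ratio q < r" by (simp add: eventually_at_filter)
  qed
  moreover have "q \<in> K" using far[OF q(1)] q(2) by auto
  ultimately obtain p where p: "p \<in> K" "\<And>q. q \<in> K \<Longrightarrow> ratio q \<le> ratio p"
    using upper_semicontinuous_on_attains_max[OF _ K] by (metis empty_iff)
  define M where "M = ratio p"
  have pD: "p \<in> {s1..T} \<times> half_plane" using p(1) KD by auto
  have "\<eta> < M"
    using ratio[OF q(1), of \<eta>] q(2) p(2)[OF \<open>q \<in> K\<close>] ratio_def \<psi>_pos[OF q(1)]
    unfolding M_def by (smt (verit) pos_less_divide_eq)
  moreover have wp: "w p = u p + M * \<psi> p" using \<psi>_pos[OF pD] by (simp add: M_def ratio_def)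
  moreover have "p \<in> {s1<..T} \<times> half_plane"
  proof -
    have "fst p \<noteq> s1"
    proof
      assume "fst p = s1"
      then have "w p \<le> u p + \<eta> * \<psi> p" using init[of "snd p"] pD by (cases p) auto
      then show False using wp \<open>\<eta> < M\<close> \<psi>_pos[OF pD] by simp
    qed
    then show ?thesis using pD by (cases p) auto
  qed
  moreover have "w q \<le> u q + M * \<psi> q" if "q \<in> {s1..T} \<times> half_plane" for q
  proof (cases "q \<in> K")
    case True
    then show ?thesis using p(2)[OF True] ratio[OF that, of M] M_def
      using \<psi>_pos[OF that] by (simp add: ratio_def divide_le_eq algebra_simps)
  next
    case False
    have "\<eta> * \<psi> q \<le> M * \<psi> q" using \<open>\<eta> < M\<close> \<psi>_pos[OF that] by simp
    then show ?thesis using far[OF that False] by linarith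
  qed
  ultimately show ?thesis using that by blast
qed

section \<open>The Heston operator\<close>

locale heston =
  fixes a b c d varrho lam \<sigma> \<rho> :: real
  assumes rho: "\<bar>\<rho>\<bar> \<le> 1" and lam_pos: "0 < lam" and sigma_pos: "0 < \<sigma>"
begin

text \<open>The linear part \<open>\<partial>\<^sub>s - L\<close> of the equation, without the
  source. On functions independent of time it equals \<open>- L\<close>, so
  \<open>- heston_op\<close> plays the role of \<open>L\<close> below.\<close>

definition heston_op :: "(real \<times> real \<times> real \<Rightarrow> real) \<Rightarrow> real \<times> real \<times> real \<Rightarrow> real" where
  "heston_op \<phi> p = dir_deriv (1, 0, 0) \<phi> p
     - (snd (snd p) / 2) *
       (lam\<^sup>2 * dir_deriv (0, 1, 0) (dir_deriv (0, 1, 0) \<phi>) p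
        + 2 * \<rho> * lam * \<sigma> * dir_deriv (0, 1, 0) (dir_deriv (0, 0, 1) \<phi>) p
        + \<sigma>\<^sup>2 * dir_deriv (0, 0, 1) (dir_deriv (0, 0, 1) \<phi>) p)
     - (c + d * snd (snd p)) * dir_deriv (0, 1, 0) \<phi> p
     - (a - b * snd (snd p)) * dir_deriv (0, 0, 1) \<phi> p - varrho * \<phi> p"

lemma heston_op_add:
  "smooth f \<Longrightarrow> smooth g \<Longrightarrow> heston_op (\<lambda>p. f p + g p) p = heston_op f p + heston_op g p"
  by (simp add: heston_op_def dir_deriv_add smooth_dir_deriv algebra_simps)

lemma heston_op_cmult: "smooth f \<Longrightarrow> heston_op (\<lambda>p. r * f p) p = r * heston_op f p"
  by (simp add: heston_op_def dir_deriv_cmult smooth_dir_deriv algebra_simps)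

lemma heston_op_uminus: "smooth f \<Longrightarrow> heston_op (\<lambda>p. - f p) p = - heston_op f p"
  using heston_op_cmult[of f "-1"] by simp

lemma heston_op_zero: "heston_op (\<lambda>p. 0) p = 0"
  by (simp add: heston_op_def dir_deriv_const)

text \<open>\<open>L\<close> differentiates in space only and its coefficients do not depend on
  time, so a time factor passes through it and contributes just its own derivative.\<close>

lemma heston_op_time_power:
  assumes q: "smooth q" and stationary: "dir_deriv (1, 0, 0) q = (\<lambda>p. 0)"
  shows "heston_op (\<lambda>p. (fst p - s1) ^ m * q p) p
    = real m * (fst p - s1) ^ (m - 1) * q p + (fst p - s1) ^ m * heston_op q p"
proof -
  define \<tau> where "\<tau> p = (fst p - s1) ^ m" for p :: "real \<times> real \<times> real"
  have \<tau>: "smooth \<tau>" unfolding \<tau>_def[abs_def] by (intro smooth_intros)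
  have d\<tau>: "dir_deriv v \<tau> = (\<lambda>p. real m * (fst p - s1) ^ (m - 1) * fst v)" for v
    unfolding \<tau>_def[abs_def] by (simp add: dir_deriv_simps smooth_intros)
  have space: "dir_deriv v (\<lambda>p. \<tau> p * f p) = (\<lambda>p. \<tau> p * dir_deriv v f p)"
    if "smooth f" "fst v = 0" for f v
    using that \<tau> by (simp add: dir_deriv_mult d\<tau>)
  have "heston_op (\<lambda>p. \<tau> p * q p) p = real m * (fst p - s1) ^ (m - 1) * q p + \<tau> p * heston_op q p"
    using q \<tau> stationary
    by (simp add: heston_op_def space smooth_dir_deriv dir_deriv_mult[of \<tau> q "(1, 0, 0)"] d\<tau>
        algebra_simps)
  then show ?thesis by (simp add: \<tau>_def)
qed

section \<open>Action of the operator on polynomials in space\<close>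

text \<open>\<open>n\<close> bounds the degree and \<open>B\<close> the sum of the absolute
  coefficients of some representation. Zero coefficients are exempt from the degree bound: truncated
  exponents such as \<open>i - 2\<close> with \<open>i = 0\<close> produce vanishing terms of too
  large formal degree.\<close>

inductive spatial_polynomial :: "nat \<Rightarrow> real \<Rightarrow> (real \<times> real \<times> real \<Rightarrow> real) \<Rightarrow> bool" for n where
  monomial: "(k \<noteq> 0 \<Longrightarrow> i + j \<le> n) \<Longrightarrow> \<bar>k\<bar> \<le> B \<Longrightarrow>
    spatial_polynomial n B (\<lambda>p. k * (fst (snd p) ^ i * snd (snd p) ^ j))"
| add: "spatial_polynomial n B P \<Longrightarrow> spatial_polynomial n B' Q \<Longrightarrow>
    spatial_polynomial n (B + B') (\<lambda>p. P p + Q p)"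

lemma spatial_polynomial_smooth: "spatial_polynomial n B q \<Longrightarrow> smooth q"
  by (induction rule: spatial_polynomial.induct) (intro smooth_intros; assumption)+

lemma spatial_polynomial_stationary:
  "spatial_polynomial n B q \<Longrightarrow> dir_deriv (1, 0, 0) q = (\<lambda>p. 0)"
proof (induction rule: spatial_polynomial.induct)
  case (monomial k i j B)
  show ?case by (simp add: dir_deriv_simps smooth_intros)
next
  case (add B P B' Q)
  then show ?case by (simp add: dir_deriv_add spatial_polynomial_smooth)
qed

lemma spatial_polynomial_bound:
  assumes "spatial_polynomial n B q" "p \<in> I \<times> half_plane"
  shows "\<bar>q p\<bar> \<le> B * (1 + (\<bar>fst (snd p)\<bar> + snd (snd p))) ^ n"
  using assms(1)
proof (induction rule: spatial_polynomial.induct)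
  case (monomial k i j B)
  define r where "r = 1 + (\<bar>fst (snd p)\<bar> + snd (snd p))"
  have y: "0 \<le> snd (snd p)" using assms(2) by (simp add: mem_half_plane)
  show ?case
  proof (cases "k = 0")
    case True
    then show ?thesis using monomial y by simp
  next
    case False
    have "\<bar>fst (snd p)\<bar> ^ i * \<bar>snd (snd p)\<bar> ^ j \<le> r ^ i * r ^ j"
      using y by (intro mult_mono power_mono) (auto simp: r_def)
    also have "\<dots> \<le> r ^ n"
      using monomial(1)[OF False] y unfolding power_add[symmetric]
      by (intro power_increasing) (auto simp: r_def)
    finally have "\<bar>k\<bar> * (\<bar>fst (snd p)\<bar> ^ i * \<bar>snd (snd p)\<bar> ^ j) \<le> B * r ^ n"
      using monomial(2) by (intro mult_mono) auto
    then show ?thesis by (simp add: abs_mult power_abs r_def)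
  qed
next
  case (add B P B' Q)
  then show ?case by (simp add: distrib_right)
qed

text \<open>Second-order coefficients are linear in \<open>y\<close> and drift coefficients affine,
  so multiplication raises the degree by no more than differentiation lowers it. The eight terms are
  kept apart so that each coefficient can be estimated alone.\<close>

lemma heston_op_monomial:
  "- heston_op (\<lambda>p. fst (snd p) ^ i * snd (snd p) ^ j) (t, x, y) =
     lam\<^sup>2 / 2 * (real i * real (i - 1)) * (x ^ (i - 2) * y ^ (j + 1))
     + \<rho> * lam * \<sigma> * (real i * real j) * (x ^ (i - 1) * y ^ j)
     + \<sigma>\<^sup>2 / 2 * (real j * real (j - 1)) * (x ^ i * y ^ (j - 1))
     + c * real i * (x ^ (i - 1) * y ^ j)
     + d * real i * (x ^ (i - 1) * y ^ (j + 1))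
     + a * real j * (x ^ i * y ^ (j - 1))
     + - b * real j * (x ^ i * y ^ j)
     + varrho * (x ^ i * y ^ j)"
proof -
  \<comment> \<open>Powers of \<open>y\<close> are recombined after differentiation; where the
    truncated exponents are wrong, the factors \<open>real j\<close> and \<open>real (j - 1)\<close>
    vanish.\<close>
  have j1: "real j * y ^ j = y * (real j * y ^ (j - 1))" by (cases j) auto
  have j2: "real j * real (j - 1) * y ^ (j - 1) = y * (real j * (real (j - 1) * y ^ (j - 1 - 1)))"
    by (cases j; cases "j - 1") auto
  have x2: "x ^ (i - 2) = x ^ (i - 1 - 1)" by (simp add: numeral_2_eq_2)
  have "- heston_op (\<lambda>p. fst (snd p) ^ i * snd (snd p) ^ j) (t, x, y) =
     lam\<^sup>2 / 2 * (real i * real (i - 1)) * (x ^ (i - 1 - 1) * (y * y ^ j))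
     + \<rho> * lam * \<sigma> * real i * (x ^ (i - 1)) * (y * (real j * y ^ (j - 1)))
     + \<sigma>\<^sup>2 / 2 * x ^ i * (y * (real j * (real (j - 1) * y ^ (j - 1 - 1))))
     + c * real i * (x ^ (i - 1) * y ^ j)
     + d * real i * (x ^ (i - 1) * (y * y ^ j))
     + a * real j * (x ^ i * y ^ (j - 1))
     + - b * x ^ i * (y * (real j * y ^ (j - 1)))
     + varrho * (x ^ i * y ^ j)"
    by (simp add: heston_op_def dir_deriv_simps smooth_intros field_simps)
  then show ?thesis unfolding j1[symmetric] j2[symmetric] x2 by (simp add: mult_ac)
qed

text \<open>A bound for the norm of \<open>L\<close> on coefficient sums in degree at most
  \<open>n\<close>: eight terms, each with an equation coefficient bounded by the sum in parentheses
  and an index factor of at most \<open>(1 + real n)\<^sup>2\<close>.\<close>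

definition growth_rate :: "nat \<Rightarrow> real" where
  "growth_rate n = 8 * ((lam\<^sup>2 + lam * \<sigma> + \<sigma>\<^sup>2 + \<bar>a\<bar> + \<bar>b\<bar> + \<bar>c\<bar> + \<bar>d\<bar> + \<bar>varrho\<bar>) * (1 + real n)\<^sup>2)"

text \<open>Stability of the degree together with a fixed factor for the coefficients gives the
  iterates of \<open>L\<close> at most geometric growth, which the factorials of the exponential
  series beat.\<close>

lemma spatial_polynomial_heston_op:
  assumes "spatial_polynomial n B q"
  shows "spatial_polynomial n (growth_rate n * B) (\<lambda>p. - heston_op q p)"
  using assms
proof (induction rule: spatial_polynomial.induct)
  case (monomial k i j B)
  define S where "S = lam\<^sup>2 + lam * \<sigma> + \<sigma>\<^sup>2 + \<bar>a\<bar> + \<bar>b\<bar> + \<bar>c\<bar> + \<bar>d\<bar> + \<bar>varrho\<bar>"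
  define N where "N = (1 + real n)\<^sup>2"
  have nonneg: "0 \<le> lam\<^sup>2" "0 \<le> lam * \<sigma>" "0 \<le> \<sigma>\<^sup>2" using lam_pos sigma_pos by auto
  \<comment> \<open>Here \<alpha> is a coefficient of the equation and \<mu> the index factor
    produced by differentiation; the degree is checked only where \<mu> does not vanish.\<close>
  have coeff: "spatial_polynomial n (S * N * B)
      (\<lambda>p. (k * (\<alpha> * \<mu>)) * (fst (snd p) ^ i' * snd (snd p) ^ j'))"
    if "\<bar>\<alpha>\<bar> \<le> S" "0 \<le> \<mu>" "k \<noteq> 0 \<Longrightarrow> \<mu> \<le> N" "\<mu> \<noteq> 0 \<Longrightarrow> i + j \<le> n \<Longrightarrow> i' + j' \<le> n" for \<alpha> \<mu> i' j'
  proof (rule spatial_polynomial.monomial)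
    show "i' + j' \<le> n" if "k * (\<alpha> * \<mu>) \<noteq> 0"
      using that \<open>\<mu> \<noteq> 0 \<Longrightarrow> i + j \<le> n \<Longrightarrow> i' + j' \<le> n\<close> monomial(1) by auto
    show "\<bar>k * (\<alpha> * \<mu>)\<bar> \<le> S * N * B"
    proof (cases "k = 0")
      case True
      then show ?thesis using monomial(2) nonneg by (simp add: S_def N_def)
    next
      case False
      have "\<bar>k\<bar> * (\<bar>\<alpha>\<bar> * \<mu>) \<le> B * (S * N)"
        using that False monomial(2) by (intro mult_mono) auto
      then show ?thesis using that(2) by (simp add: abs_mult mult_ac)
    qed
  qed
  have le: "real i \<le> 1 + real n" "real j \<le> 1 + real n" if "k \<noteq> 0"
    using monomial(1)[OF that] by auto
  have N: "real i * real (i - 1) \<le> N" "real i * real j \<le> N" "real j * real (j - 1) \<le> N"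
    "real i \<le> N" "real j \<le> N" "1 \<le> N" if "k \<noteq> 0"
  proof -
    have "real (i - 1) \<le> 1 + real n" "real (j - 1) \<le> 1 + real n" using le[OF that] by auto
    then show "real i * real (i - 1) \<le> N" "real i * real j \<le> N" "real j * real (j - 1) \<le> N"
      unfolding N_def power2_eq_square using le[OF that] by (auto intro!: mult_mono)
    have "real i * 1 \<le> (1 + real n) * (1 + real n)" "real j * 1 \<le> (1 + real n) * (1 + real n)"
      by (intro mult_mono; use le[OF that] in simp)+
    then show "real i \<le> N" "real j \<le> N" "1 \<le> N" unfolding N_def power2_eq_square
      by (auto simp: algebra_simps)
  qed
  have "\<bar>\<rho> * lam * \<sigma>\<bar> \<le> 1 * (lam * \<sigma>)"
    using rho lam_pos sigma_pos mult_right_mono[OF rho, of "lam * \<sigma>"] by (simp add: abs_mult mult_ac)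
  then have S: "\<bar>lam\<^sup>2 / 2\<bar> \<le> S" "\<bar>\<rho> * lam * \<sigma>\<bar> \<le> S" "\<bar>\<sigma>\<^sup>2 / 2\<bar> \<le> S" "\<bar>c\<bar> \<le> S" "\<bar>d\<bar> \<le> S" "\<bar>a\<bar> \<le> S"
    "\<bar>- b\<bar> \<le> S" "\<bar>varrho\<bar> \<le> S"
    using nonneg unfolding S_def by linarith+
  have deg: "real i * real (i - 1) \<noteq> 0 \<Longrightarrow> i + j \<le> n \<Longrightarrow> i - 2 + (j + 1) \<le> n"
    "real i * real j \<noteq> 0 \<Longrightarrow> i + j \<le> n \<Longrightarrow> i - 1 + j \<le> n"
    "real j * real (j - 1) \<noteq> 0 \<Longrightarrow> i + j \<le> n \<Longrightarrow> i + (j - 1) \<le> n"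
    "real i \<noteq> 0 \<Longrightarrow> i + j \<le> n \<Longrightarrow> i - 1 + j \<le> n"
    "real i \<noteq> 0 \<Longrightarrow> i + j \<le> n \<Longrightarrow> i - 1 + (j + 1) \<le> n"
    "real j \<noteq> 0 \<Longrightarrow> i + j \<le> n \<Longrightarrow> i + (j - 1) \<le> n" by auto
  note terms = coeff[OF S(1) _ N(1) deg(1)] coeff[OF S(2) _ N(2) deg(2)] coeff[OF S(3) _ N(3) deg(3)]
    coeff[OF S(4) _ N(4) deg(4)] coeff[OF S(5) _ N(4) deg(5)] coeff[OF S(6) _ N(5) deg(6)]
    coeff[OF S(7) _ N(5), of i j] coeff[OF S(8) _ N(6), of i j]
  have "spatial_polynomial n (S * N * B + S * N * B + S * N * B + S * N * B + S * N * B + S * N * B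
      + S * N * B + S * N * B) (\<lambda>p.
     (k * (lam\<^sup>2 / 2 * (real i * real (i - 1)))) * (fst (snd p) ^ (i - 2) * snd (snd p) ^ (j + 1))
     + (k * (\<rho> * lam * \<sigma> * (real i * real j))) * (fst (snd p) ^ (i - 1) * snd (snd p) ^ j)
     + (k * (\<sigma>\<^sup>2 / 2 * (real j * real (j - 1)))) * (fst (snd p) ^ i * snd (snd p) ^ (j - 1))
     + (k * (c * real i)) * (fst (snd p) ^ (i - 1) * snd (snd p) ^ j)
     + (k * (d * real i)) * (fst (snd p) ^ (i - 1) * snd (snd p) ^ (j + 1))
     + (k * (a * real j)) * (fst (snd p) ^ i * snd (snd p) ^ (j - 1))
     + (k * (- b * real j)) * (fst (snd p) ^ i * snd (snd p) ^ j)
     + (k * (varrho * 1)) * (fst (snd p) ^ i * snd (snd p) ^ j))"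
    by (intro spatial_polynomial.add terms) auto
  also have "S * N * B + S * N * B + S * N * B + S * N * B + S * N * B + S * N * B
      + S * N * B + S * N * B = growth_rate n * B"
    by (simp add: growth_rate_def S_def N_def)
  also have "(\<lambda>p.
     (k * (lam\<^sup>2 / 2 * (real i * real (i - 1)))) * (fst (snd p) ^ (i - 2) * snd (snd p) ^ (j + 1))
     + (k * (\<rho> * lam * \<sigma> * (real i * real j))) * (fst (snd p) ^ (i - 1) * snd (snd p) ^ j)
     + (k * (\<sigma>\<^sup>2 / 2 * (real j * real (j - 1)))) * (fst (snd p) ^ i * snd (snd p) ^ (j - 1))
     + (k * (c * real i)) * (fst (snd p) ^ (i - 1) * snd (snd p) ^ j)
     + (k * (d * real i)) * (fst (snd p) ^ (i - 1) * snd (snd p) ^ (j + 1))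
     + (k * (a * real j)) * (fst (snd p) ^ i * snd (snd p) ^ (j - 1))
     + (k * (- b * real j)) * (fst (snd p) ^ i * snd (snd p) ^ j)
     + (k * (varrho * 1)) * (fst (snd p) ^ i * snd (snd p) ^ j))
     = (\<lambda>p. - heston_op (\<lambda>p. k * (fst (snd p) ^ i * snd (snd p) ^ j)) p)" (is "?l = ?r")
  proof
    fix p :: "real \<times> real \<times> real"
    obtain t x y where p: "p = (t, x, y)" by (cases p)
    have "smooth (\<lambda>p :: real \<times> real \<times> real. fst (snd p) ^ i * snd (snd p) ^ j)"
      by (intro smooth_intros)
    then have "?r p = k * - heston_op (\<lambda>p. fst (snd p) ^ i * snd (snd p) ^ j) p"
      by (simp add: heston_op_cmult)
    also have "\<dots> = ?l p" unfolding p heston_op_monomial fst_conv snd_conv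
      by (simp only: distrib_left mult_ac mult_1_right)
    finally show "?l p = ?r p" ..
  qed
  finally show ?case .
next
  case (add B P B' Q)
  have "(\<lambda>p. - heston_op (\<lambda>p. P p + Q p) p) = (\<lambda>p. - heston_op P p + - heston_op Q p)"
    using add.hyps by (simp add: heston_op_add spatial_polynomial_smooth)
  then show ?case using spatial_polynomial.add[OF add.IH] by (simp only: distrib_left)
qed

text \<open>Duhamel's formula for the time monomial of degree \<open>m - 1\<close>, resp. the evolution of the
  initial value \<open>q\<close> for \<open>m = 0\<close>, truncated after \<open>N\<close> terms of the exponential series.\<close>

definition evolution :: "real \<Rightarrow> nat \<Rightarrow> nat \<Rightarrow> (real \<times> real \<times> real \<Rightarrow> real) \<Rightarrow> real \<times> real \<times> real \<Rightarrow> real" where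
  "evolution s1 m N q p = (\<Sum>k\<le>N. 1 / fact (m + k) *
     ((fst p - s1) ^ (m + k) * ((\<lambda>q p. - heston_op q p) ^^ k) q p))"

lemma spatial_polynomial_iterate:
  assumes "spatial_polynomial n B q"
  shows "spatial_polynomial n (growth_rate n ^ k * B) (((\<lambda>q p. - heston_op q p) ^^ k) q)"
  using assms by (induction k) (auto dest: spatial_polynomial_heston_op simp: mult.assoc)

lemma smooth_evolution:
  "spatial_polynomial n B q \<Longrightarrow> smooth (evolution s1 m N q)"
  unfolding evolution_def[abs_def]
  by (intro smooth_intros) (rule spatial_polynomial_smooth[OF spatial_polynomial_iterate])

text \<open>The sum telescopes: the time derivative of each term cancels \<open>L\<close> applied to
  the previous one. What remains is the time derivative of the first term, which is the source and
  vanishes for \<open>m = 0\<close>, and \<open>L\<close> of the last.\<close>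

lemma heston_op_evolution:
  assumes q: "spatial_polynomial n B q"
  shows "heston_op (evolution s1 m N q) p =
    (if m = 0 then 0 else (fst p - s1) ^ (m - 1) / fact (m - 1) * q p)
    - (fst p - s1) ^ (m + N) / fact (m + N) * ((\<lambda>q p. - heston_op q p) ^^ Suc N) q p"
proof -
  define Q where "Q k = ((\<lambda>q p. - heston_op q p) ^^ k) q" for k
  have Q: "smooth (Q k)" "dir_deriv (1, 0, 0) (Q k) = (\<lambda>p. 0)" for k
    unfolding Q_def using spatial_polynomial_iterate[OF q]
    by (blast intro: spatial_polynomial_smooth spatial_polynomial_stationary)+
  have Suc_Q: "heston_op (Q k) p = - Q (Suc k) p" for k by (simp add: Q_def)
  have sm: "smooth (\<lambda>p. (fst p - s1) ^ l * Q k p)" for l k by (intro smooth_intros Q)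
  have step: "heston_op (\<lambda>p. 1 / fact l * ((fst p - s1) ^ l * Q k p)) p =
      (if l = 0 then 0 else (fst p - s1) ^ (l - 1) / fact (l - 1) * Q k p)
      - (fst p - s1) ^ l / fact l * Q (Suc k) p" for l k
  proof -
    have "heston_op (\<lambda>p. 1 / fact l * ((fst p - s1) ^ l * Q k p)) p =
      1 / fact l * (real l * (fst p - s1) ^ (l - 1) * Q k p - (fst p - s1) ^ l * Q (Suc k) p)"
      by (subst heston_op_cmult[OF sm], subst heston_op_time_power[OF Q], subst Suc_Q) simp
    also have "\<dots> = real l / fact l * ((fst p - s1) ^ (l - 1) * Q k p)
      - (fst p - s1) ^ l / fact l * Q (Suc k) p"
      by (simp add: right_diff_distrib)
    also have "real l / fact l = (if l = 0 then 0 else 1 / fact (l - 1))"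
      by (cases l) (auto simp del: of_nat_Suc)
    finally show ?thesis by simp
  qed
  have "heston_op (evolution s1 m N q) p =
      (if m = 0 then 0 else (fst p - s1) ^ (m - 1) / fact (m - 1) * Q 0 p)
      - (fst p - s1) ^ (m + N) / fact (m + N) * Q (Suc N) p"
  proof (induction N)
    case 0
    show ?case using step[of m 0] by (simp add: evolution_def[abs_def] Q_def)
  next
    case (Suc N)
    have eq: "evolution s1 m (Suc N) q = (\<lambda>p. evolution s1 m N q p +
        1 / fact (m + Suc N) * ((fst p - s1) ^ (m + Suc N) * Q (Suc N) p))"
      by (simp add: evolution_def[abs_def] Q_def)
    have "heston_op (evolution s1 m (Suc N) q) p = heston_op (evolution s1 m N q) p +
        heston_op (\<lambda>p. 1 / fact (m + Suc N) * ((fst p - s1) ^ (m + Suc N) * Q (Suc N) p)) p"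
      by (subst eq) (rule heston_op_add[OF smooth_evolution[OF q] smooth_mult[OF smooth_const sm]])
    then show ?case unfolding Suc.IH step by simp
  qed
  then show ?thesis by (simp add: Q_def)
qed

lemma evolution_initial:
  "evolution s1 m N q (s1, z) = (if m = 0 then q (s1, z) else 0)"
  by (cases "m = 0") (simp_all add: evolution_def sum.atMost_shift power_0_left)

lemma evolution_approximate:
  assumes q: "spatial_polynomial n B q" and pos: "\<epsilon> > 0" "\<eta> > 0"
  obtains u where "smooth u" "subexponential_on {s1..T} u"
    "\<And>z. u (s1, z) = (if m = 0 then q (s1, z) else 0)"
    "\<And>p. p \<in> {s1..T} \<times> half_plane \<Longrightarrow>
      \<bar>heston_op u p - (if m = 0 then 0 else (fst p - s1) ^ (m - 1) / fact (m - 1) * q p)\<bar>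
        \<le> \<eta> * exp_weight \<epsilon> p"
proof -
  have radius: "subexponential_on {s1..T} (\<lambda>p. (1 + (\<bar>fst (snd p)\<bar> + snd (snd p))) ^ n)"
    by (intro subexponential_on_power subexponential_on_add subexponential_on_const
        subexponential_on_radius)
  obtain C where C: "C > 0" "\<And>p. p \<in> {s1..T} \<times> half_plane \<Longrightarrow>
      \<bar>(1 + (\<bar>fst (snd p)\<bar> + snd (snd p))) ^ n\<bar> \<le> C * exp_weight \<epsilon> p"
    using subexponential_onE[OF radius pos(1)] by metis
  \<comment> \<open>One constant at least 1 dominating both the time span and the growth rate, so
    that the remainder is at most a multiple of
    \<open>(A\<^sup>2) ^ (m + N) / fact (m + N)\<close>.\<close>
  define A where "A = max 1 (max \<bar>T - s1\<bar> \<bar>growth_rate n\<bar>)"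
  have A: "1 \<le> A" "\<bar>T - s1\<bar> \<le> A" "\<bar>growth_rate n\<bar> \<le> A" by (auto simp: A_def)
  have "(\<lambda>l. inverse (fact l) * (A\<^sup>2) ^ l) \<longlonglongrightarrow> 0"
    by (rule summable_LIMSEQ_zero[OF summable_exp])
  then have "(\<lambda>l. A * \<bar>B\<bar> * C * (inverse (fact l) * (A\<^sup>2) ^ l)) \<longlonglongrightarrow> 0"
    by (rule tendsto_mult_right_zero)
  then have "\<forall>\<^sub>F l in sequentially. A * \<bar>B\<bar> * C * (inverse (fact l) * (A\<^sup>2) ^ l) < \<eta>"
    using pos(2) by (rule order_tendstoD)
  then obtain N where N: "A * \<bar>B\<bar> * C * (inverse (fact (m + N)) * (A\<^sup>2) ^ (m + N)) < \<eta>"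
    unfolding eventually_sequentially by (metis le_add2)
  define Q where "Q k = ((\<lambda>q p. - heston_op q p) ^^ k) q" for k
  have remainder: "\<bar>(fst p - s1) ^ (m + N) / fact (m + N) * Q (Suc N) p\<bar> \<le> \<eta> * exp_weight \<epsilon> p"
    if p: "p \<in> {s1..T} \<times> half_plane" for p
  proof -
    have "\<bar>Q (Suc N) p\<bar> \<le> growth_rate n ^ Suc N * B * (1 + (\<bar>fst (snd p)\<bar> + snd (snd p))) ^ n"
      unfolding Q_def by (rule spatial_polynomial_bound[OF spatial_polynomial_iterate[OF q] p])
    also have "\<dots> \<le> \<bar>growth_rate n ^ Suc N * B\<bar> * \<bar>(1 + (\<bar>fst (snd p)\<bar> + snd (snd p))) ^ n\<bar>"
      by (metis abs_ge_self abs_mult)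
    also have "\<dots> \<le> (A ^ Suc (m + N) * \<bar>B\<bar>) * (C * exp_weight \<epsilon> p)"
    proof (intro mult_mono C(2)[OF p])
      have "\<bar>growth_rate n\<bar> ^ Suc N \<le> A ^ Suc N" using A by (intro power_mono) auto
      also have "\<dots> \<le> A ^ Suc (m + N)" using A by (intro power_increasing) auto
      finally show "\<bar>growth_rate n ^ Suc N * B\<bar> \<le> A ^ Suc (m + N) * \<bar>B\<bar>"
        unfolding abs_mult power_abs by (intro mult_right_mono) auto
    qed (use A in auto)
    finally have 1: "\<bar>Q (Suc N) p\<bar> \<le> (A ^ Suc (m + N) * \<bar>B\<bar>) * (C * exp_weight \<epsilon> p)" .
    have "\<bar>fst p - s1\<bar> \<le> A" using p A by (auto simp: mem_half_plane)
    then have 2: "\<bar>fst p - s1\<bar> ^ (m + N) \<le> A ^ (m + N)" by (intro power_mono) auto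
    have "\<bar>(fst p - s1) ^ (m + N) / fact (m + N) * Q (Suc N) p\<bar>
        = inverse (fact (m + N)) * (\<bar>fst p - s1\<bar> ^ (m + N) * \<bar>Q (Suc N) p\<bar>)"
      by (simp add: abs_mult power_abs divide_inverse)
    also have "\<dots> \<le> inverse (fact (m + N)) *
        (A ^ (m + N) * ((A ^ Suc (m + N) * \<bar>B\<bar>) * (C * exp_weight \<epsilon> p)))"
      using 1 2 A by (intro mult_left_mono mult_mono) auto
    also have "\<dots> = (A * \<bar>B\<bar> * C * (inverse (fact (m + N)) * (A\<^sup>2) ^ (m + N))) * exp_weight \<epsilon> p"
      by (simp add: power2_eq_square power_mult_distrib mult_ac)
    also have "\<dots> \<le> \<eta> * exp_weight \<epsilon> p"
      using N exp_weight_pos[of \<epsilon> p] by (intro mult_right_mono) auto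
    finally show ?thesis .
  qed
  have sub: "subexponential_on {s1..T} (evolution s1 m N q)"
    unfolding evolution_def[abs_def]
  proof (intro subexponential_on_sum subexponential_on_mult subexponential_on_power
      subexponential_on_time subexponential_on_const)
    fix k
    show "subexponential_on {s1..T} (((\<lambda>q p. - heston_op q p) ^^ k) q)"
    proof (rule subexponential_on_dominated)
      show "subexponential_on {s1..T} (\<lambda>p. growth_rate n ^ k * B *
          (1 + (\<bar>fst (snd p)\<bar> + snd (snd p))) ^ n)"
        by (intro subexponential_on_mult[OF subexponential_on_const radius])
      show "\<bar>((\<lambda>q p. - heston_op q p) ^^ k) q p\<bar> \<le>
          \<bar>growth_rate n ^ k * B * (1 + (\<bar>fst (snd p)\<bar> + snd (snd p))) ^ n\<bar>"
        if "p \<in> {s1..T} \<times> half_plane" for p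
        using spatial_polynomial_bound[OF spatial_polynomial_iterate[OF q] that] by (rule order_trans) simp
    qed
  qed
  show ?thesis
    by (rule that[of "evolution s1 m N q"])
       (use remainder in \<open>simp_all add: heston_op_evolution[OF q] smooth_evolution[OF q] sub
          evolution_initial Q_def\<close>)
qed

section \<open>Smooth approximate solutions of the inhomogeneous equation\<close>

lemma polynomial_source_approximate:
  assumes "polynomial_about s1 P" and "\<epsilon> > 0" "\<eta> > 0"
  shows "\<exists>u. smooth u \<and> subexponential_on {s1..T} u \<and> (\<forall>z. u (s1, z) = 0) \<and>
    (\<forall>p\<in>{s1..T} \<times> half_plane. \<bar>heston_op u p - P p\<bar> \<le> \<eta> * exp_weight \<epsilon> p)"
  using assms
proof (induction arbitrary: \<eta> rule: polynomial_about.induct)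
  case (monomial k m i j)
  \<comment> \<open>The factor \<open>fact m\<close> cancels the factorial in the source of
    \<open>evolution\<close>, which is taken at \<open>Suc m\<close> to produce the time power
    \<open>m\<close>.\<close>
  define q where "q p = (k * fact m) * (fst (snd p) ^ i * snd (snd p) ^ j)" for p :: "real \<times> real \<times> real"
  have "spatial_polynomial (i + j) \<bar>k * fact m\<bar> q"
    unfolding q_def[abs_def] by (rule spatial_polynomial.monomial) auto
  then obtain u where "smooth u" "subexponential_on {s1..T} u" "\<And>z. u (s1, z) = 0"
    and u: "\<And>p. p \<in> {s1..T} \<times> half_plane \<Longrightarrow>
      \<bar>heston_op u p - (fst p - s1) ^ m / fact m * q p\<bar> \<le> \<eta> * exp_weight \<epsilon> p"
    using evolution_approximate[of "i + j" _ q \<epsilon> \<eta> s1 T "Suc m"] monomial.prems by auto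
  moreover have "(fst p - s1) ^ m / fact m * q p =
      k * ((fst p - s1) ^ m * (fst (snd p) ^ i * snd (snd p) ^ j))" for p
    by (simp add: q_def)
  ultimately show ?case by (intro exI[of _ u]) simp
next
  case (add P Q)
  have "\<eta> / 2 > 0" using add.prems by simp
  from add.IH(1)[OF add.prems(1) this] add.IH(2)[OF add.prems(1) this]
  obtain u1 u2 where u: "smooth u1" "subexponential_on {s1..T} u1" "\<forall>z. u1 (s1, z) = 0"
    "smooth u2" "subexponential_on {s1..T} u2" "\<forall>z. u2 (s1, z) = 0"
    "\<forall>p\<in>{s1..T} \<times> half_plane. \<bar>heston_op u1 p - P p\<bar> \<le> \<eta> / 2 * exp_weight \<epsilon> p"
    "\<forall>p\<in>{s1..T} \<times> half_plane. \<bar>heston_op u2 p - Q p\<bar> \<le> \<eta> / 2 * exp_weight \<epsilon> p" by blast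
  have "\<bar>heston_op (\<lambda>p. u1 p + u2 p) p - (P p + Q p)\<bar> \<le> \<eta> * exp_weight \<epsilon> p"
    if "p \<in> {s1..T} \<times> half_plane" for p
    using u(7)[rule_format, OF that] u(8)[rule_format, OF that] heston_op_add[OF u(1,4), of p]
    by linarith
  then show ?case
    using u by (intro exI[of _ "\<lambda>p. u1 p + u2 p"]) (simp add: smooth_add subexponential_on_add)
qed

lemma polynomial_initial_approximate:
  assumes "polynomial_about s1 P" and "\<epsilon> > 0" "\<eta> > 0"
  shows "\<exists>u. smooth u \<and> subexponential_on {s1..T} u \<and> (\<forall>z. u (s1, z) = P (s1, z)) \<and>
    (\<forall>p\<in>{s1..T} \<times> half_plane. \<bar>heston_op u p\<bar> \<le> \<eta> * exp_weight \<epsilon> p)"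
  using assms
proof (induction arbitrary: \<eta> rule: polynomial_about.induct)
  case (monomial k m i j)
  show ?case
  proof (cases "m = 0")
    case True
    define q where "q p = k * (fst (snd p) ^ i * snd (snd p) ^ j)" for p :: "real \<times> real \<times> real"
    have "spatial_polynomial (i + j) \<bar>k\<bar> q"
      unfolding q_def[abs_def] by (rule spatial_polynomial.monomial) auto
    then obtain u where "smooth u" "subexponential_on {s1..T} u" "\<And>z. u (s1, z) = q (s1, z)"
      and u: "\<And>p. p \<in> {s1..T} \<times> half_plane \<Longrightarrow> \<bar>heston_op u p\<bar> \<le> \<eta> * exp_weight \<epsilon> p"
      using evolution_approximate[of "i + j" _ q \<epsilon> \<eta> s1 T 0] monomial.prems by auto
    then show ?thesis using True by (intro exI[of _ u]) (simp add: q_def)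
  next
    case False
    \<comment> \<open>A monomial with a positive time power vanishes at \<open>s1\<close>, so the
      zero function has the right initial value.\<close>
    then show ?thesis
      using monomial.prems exp_weight_pos[of \<epsilon>]
      by (intro exI[of _ "\<lambda>p. 0"])
         (auto simp: heston_op_zero smooth_const subexponential_on_const less_imp_le)
  qed
next
  case (add P Q)
  have "\<eta> / 2 > 0" using add.prems by simp
  from add.IH(1)[OF add.prems(1) this] add.IH(2)[OF add.prems(1) this]
  obtain u1 u2 where u: "smooth u1" "subexponential_on {s1..T} u1" "\<forall>z. u1 (s1, z) = P (s1, z)"
    "smooth u2" "subexponential_on {s1..T} u2" "\<forall>z. u2 (s1, z) = Q (s1, z)"
    "\<forall>p\<in>{s1..T} \<times> half_plane. \<bar>heston_op u1 p\<bar> \<le> \<eta> / 2 * exp_weight \<epsilon> p"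
    "\<forall>p\<in>{s1..T} \<times> half_plane. \<bar>heston_op u2 p\<bar> \<le> \<eta> / 2 * exp_weight \<epsilon> p" by blast
  have "\<bar>heston_op (\<lambda>p. u1 p + u2 p) p\<bar> \<le> \<eta> * exp_weight \<epsilon> p"
    if "p \<in> {s1..T} \<times> half_plane" for p
    using u(7)[rule_format, OF that] u(8)[rule_format, OF that] heston_op_add[OF u(1,4), of p]
    by linarith
  then show ?case
    using u by (intro exI[of _ "\<lambda>p. u1 p + u2 p"]) (simp add: smooth_add subexponential_on_add)
qed

text \<open>By linearity the initial value and the source are treated apart: one function starts
  from a polynomial near \<open>g\<close> with nearly no source, the other starts from 0 with a
  polynomial source near \<open>- k\<close>.\<close>

lemma approximate_solution:
  assumes "s1 \<le> T"
    and g: "continuous_on ({s1..T} \<times> half_plane) g" "subexponential_on {s1..T} g"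
    and k: "continuous_on ({s1..T} \<times> half_plane) k" "subexponential_on {s1..T} k"
    and pos: "\<epsilon> > 0" "\<eta> > 0"
  obtains u where "smooth u" "subexponential_on {s1..T} u"
    "\<And>z. z \<in> half_plane \<Longrightarrow> \<bar>u (s1, z) - g (s1, z)\<bar> \<le> \<eta> * exp_weight \<epsilon> (s1, z)"
    "\<And>p. p \<in> {s1..T} \<times> half_plane \<Longrightarrow> \<bar>heston_op u p + k p\<bar> \<le> \<eta> * exp_weight \<epsilon> p"
proof -
  \<comment> \<open>The source error has three parts: from each of the two functions and from
    approximating \<open>- k\<close>.\<close>
  have \<eta>3: "\<eta> / 3 > 0" using pos by simp
  obtain P where P: "polynomial_about s1 P"
    "\<And>p. p \<in> {s1..T} \<times> half_plane \<Longrightarrow> \<bar>g p - P p\<bar> \<le> \<eta> * exp_weight \<epsilon> p"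
    using weighted_polynomial_approximation[OF g pos] by metis
  obtain Q where Q: "polynomial_about s1 Q"
    "\<And>p. p \<in> {s1..T} \<times> half_plane \<Longrightarrow> \<bar>- k p - Q p\<bar> \<le> \<eta> / 3 * exp_weight \<epsilon> p"
    using weighted_polynomial_approximation[OF continuous_on_minus[OF k(1)]
        subexponential_on_uminus[OF k(2)] pos(1) \<eta>3] by metis
  obtain u1 u2 where u: "smooth u1" "subexponential_on {s1..T} u1" "\<forall>z. u1 (s1, z) = P (s1, z)"
    "smooth u2" "subexponential_on {s1..T} u2" "\<forall>z. u2 (s1, z) = 0"
    "\<forall>p\<in>{s1..T} \<times> half_plane. \<bar>heston_op u1 p\<bar> \<le> \<eta> / 3 * exp_weight \<epsilon> p"
    "\<forall>p\<in>{s1..T} \<times> half_plane. \<bar>heston_op u2 p - Q p\<bar> \<le> \<eta> / 3 * exp_weight \<epsilon> p"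
    using polynomial_initial_approximate[OF P(1) pos(1) \<eta>3, of T]
      polynomial_source_approximate[OF Q(1) pos(1) \<eta>3, of T] by blast
  show ?thesis
  proof (rule that[of "\<lambda>p. u1 p + u2 p"])
    show "\<bar>u1 (s1, z) + u2 (s1, z) - g (s1, z)\<bar> \<le> \<eta> * exp_weight \<epsilon> (s1, z)"
      if "z \<in> half_plane" for z
      using P(2)[of "(s1, z)"] that \<open>s1 \<le> T\<close> u(3)[rule_format, of z] u(6)[rule_format, of z]
      by (simp add: abs_minus_commute)
    show "\<bar>heston_op (\<lambda>p. u1 p + u2 p) p + k p\<bar> \<le> \<eta> * exp_weight \<epsilon> p"
      if "p \<in> {s1..T} \<times> half_plane" for p
      using u(7)[rule_format, OF that] u(8)[rule_format, OF that] Q(2)[OF that]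
        heston_op_add[OF u(1,4), of p] by linarith
  qed (use u in \<open>auto intro: smooth_add subexponential_on_add\<close>)
qed

text \<open>The exponent \<open>B s\<close> must grow in time to absorb the terms of order \<open>y\<close>; since
  \<open>x * (exp (B s * x) - exp (- B s * x))\<close> is nonnegative, its growth does no harm in \<open>x\<close>.\<close>

lemma barrier_exists:
  obtains \<epsilon> \<psi> where "\<epsilon> > 0" "smooth \<psi>"
    "\<And>p. p \<in> {0..T} \<times> half_plane \<Longrightarrow> exp_weight \<epsilon> p \<le> \<psi> p"
    "\<And>p. p \<in> {0..T} \<times> half_plane \<Longrightarrow> \<psi> p \<le> heston_op \<psi> p"
proof -
  \<comment> \<open>\<kappa> dominates all terms of first order in \<open>y\<close>, coming from
    diffusion and drift; \<open>K\<close> dominates the terms free of \<open>y\<close> and leaves 1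
    over.\<close>
  define \<kappa> where "\<kappa> = (lam\<^sup>2 + 2 * lam * \<sigma> + \<sigma>\<^sup>2) / 2 + \<bar>d\<bar> + \<bar>b\<bar>"
  define K where "K = 1 + \<bar>varrho\<bar> + \<bar>c\<bar> + \<bar>a\<bar>"
  \<comment> \<open>With this choice \<open>B\<close> grows from \<epsilon> at time 0 to 1 at time
    \<open>T\<close>. Staying below 1 is essential, since then the quadratic diffusion term in
    \<open>B\<close> is bounded by a linear one.\<close>
  define \<epsilon> where "\<epsilon> = exp (- \<kappa> * T)"
  define B where "B p = \<epsilon> * exp (\<kappa> * fst p)" for p :: "real \<times> real \<times> real"
  define E where "E \<theta> p = exp (K * fst p + B p * (snd (snd p) + \<theta> * fst (snd p)))"
    for \<theta> and p :: "real \<times> real \<times> real"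
  have "\<epsilon> > 0" by (simp add: \<epsilon>_def)
  have "\<kappa> \<ge> 0" using lam_pos sigma_pos by (simp add: \<kappa>_def)
  have smB: "smooth B" unfolding B_def[abs_def] by (intro smooth_intros)
  have smE: "smooth (E \<theta>)" for \<theta> unfolding E_def[abs_def] by (intro smooth_intros smB)
  have dB: "dir_deriv v B = (\<lambda>p. \<kappa> * fst v * B p)" for v
    unfolding B_def[abs_def] by (simp add: dir_deriv_simps smooth_intros fun_eq_iff)
  have dE: "dir_deriv v (E \<theta>) = (\<lambda>p. E \<theta> p * (K * fst v + B p * (snd (snd v) + \<theta> * fst (snd v))
      + \<kappa> * fst v * B p * (snd (snd p) + \<theta> * fst (snd p))))" for v \<theta>
    unfolding E_def[abs_def] by (simp add: dir_deriv_simps dB smooth_intros smB fun_eq_iff)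
  have opE: "heston_op (E \<theta>) p = E \<theta> p * (K - varrho - (c + d * y) * (\<theta> * B p) - (a - b * y) * B p
      - y / 2 * (lam\<^sup>2 * \<theta>\<^sup>2 + 2 * \<rho> * lam * \<sigma> * \<theta> + \<sigma>\<^sup>2) * (B p)\<^sup>2
      + \<kappa> * B p * (y + \<theta> * fst (snd p)))"
    if "y = snd (snd p)" for \<theta> p y
    unfolding that
    by (simp add: heston_op_def dE dB dir_deriv_simps smooth_intros smB smE power2_eq_square algebra_simps)
  \<comment> \<open>A smooth substitute for the exponential of the absolute value of
    \<open>x\<close>: the summand whose sign agrees with \<open>x\<close> already dominates the
    weight.\<close>
  define \<psi> where "\<psi> p = E 1 p + E (- 1) p" for p
  have sm\<psi>: "smooth \<psi>" unfolding \<psi>_def[abs_def] by (intro smooth_intros smE)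
  have B_bounds: "\<epsilon> \<le> B p" "0 < B p" "B p \<le> 1" if "p \<in> {0..T} \<times> half_plane" for p
  proof -
    have s: "0 \<le> fst p" "fst p \<le> T" using that by (auto simp: mem_half_plane)
    have "1 \<le> exp (\<kappa> * fst p)" using s \<open>\<kappa> \<ge> 0\<close> by simp
    then show "\<epsilon> \<le> B p" unfolding B_def using \<open>\<epsilon> > 0\<close> by simp
    show "0 < B p" using \<open>\<epsilon> > 0\<close> by (simp add: B_def)
    have "\<kappa> * fst p \<le> \<kappa> * T" using s \<open>\<kappa> \<ge> 0\<close> by (intro mult_left_mono)
    then show "B p \<le> 1" unfolding B_def \<epsilon>_def by (simp flip: exp_add)
  qed
  show ?thesis
  proof (rule that[OF \<open>\<epsilon> > 0\<close> sm\<psi>])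
    fix p :: "real \<times> real \<times> real" assume p: "p \<in> {0..T} \<times> half_plane"
    define x y where "x = fst (snd p)" and "y = snd (snd p)"
    have y: "0 \<le> y" and s: "0 \<le> fst p" using p by (auto simp: y_def mem_half_plane)
    note B = B_bounds[OF p]
    have E_pos: "0 < E \<theta> p" for \<theta> by (simp add: E_def)
    have K: "0 \<le> K" by (simp add: K_def)
    have "\<epsilon> * (\<bar>x\<bar> + y) \<le> K * fst p + B p * (y + \<bar>x\<bar>)"
      using mult_right_mono[OF B(1), of "\<bar>x\<bar> + y"] y mult_nonneg_nonneg[OF K s]
      by (simp add: add.commute)
    then have "exp_weight \<epsilon> p \<le> exp (K * fst p + B p * (y + \<bar>x\<bar>))"
      by (simp add: exp_weight_def x_def y_def)
    also have "\<dots> \<le> \<psi> p"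
      using E_pos[of 1] E_pos[of "-1"] by (cases "0 \<le> x") (simp_all add: \<psi>_def E_def x_def y_def)
    finally show "exp_weight \<epsilon> p \<le> \<psi> p" .
    have coeff: "1 \<le> K - varrho - (c + d * y) * (\<theta> * B p) - (a - b * y) * B p
      - y / 2 * (lam\<^sup>2 * \<theta>\<^sup>2 + 2 * \<rho> * lam * \<sigma> * \<theta> + \<sigma>\<^sup>2) * (B p)\<^sup>2 + \<kappa> * B p * y"
      if \<theta>: "\<theta> = 1 \<or> \<theta> = -1" for \<theta>
    proof -
      have "\<bar>\<theta> * c * B p\<bar> \<le> \<bar>c\<bar> * 1" "\<bar>a * B p\<bar> \<le> \<bar>a\<bar> * 1"
        using B \<theta> unfolding abs_mult by (auto simp: mult_left_le)
      then have 1: "1 \<le> K - varrho - \<theta> * c * B p - a * B p"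
        unfolding K_def by linarith
      have "\<bar>\<rho> * lam * \<sigma> * \<theta>\<bar> \<le> 1 * (lam * \<sigma>)"
        using \<theta> lam_pos sigma_pos mult_right_mono[OF rho, of "lam * \<sigma>"] by (auto simp: abs_mult mult_ac)
      then have q: "lam\<^sup>2 * \<theta>\<^sup>2 + 2 * \<rho> * lam * \<sigma> * \<theta> + \<sigma>\<^sup>2 \<le> lam\<^sup>2 + 2 * lam * \<sigma> + \<sigma>\<^sup>2"
        using \<theta> by (auto simp: mult_ac abs_le_iff)
      have "0 \<le> lam\<^sup>2 + 2 * lam * \<sigma> + \<sigma>\<^sup>2" using lam_pos sigma_pos by simp
      then have "(lam\<^sup>2 * \<theta>\<^sup>2 + 2 * \<rho> * lam * \<sigma> * \<theta> + \<sigma>\<^sup>2) * B p \<le> (lam\<^sup>2 + 2 * lam * \<sigma> + \<sigma>\<^sup>2) * 1"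
        using q B by (meson less_imp_le mult_left_mono mult_right_mono order_trans)
      moreover have "\<theta> * d \<le> \<bar>d\<bar>" "- b \<le> \<bar>b\<bar>" using \<theta> by auto
      ultimately have "0 \<le> \<kappa> - \<theta> * d + b - (lam\<^sup>2 * \<theta>\<^sup>2 + 2 * \<rho> * lam * \<sigma> * \<theta> + \<sigma>\<^sup>2) * B p / 2"
        unfolding \<kappa>_def by linarith
      then have 2: "0 \<le> y * B p * (\<kappa> - \<theta> * d + b - (lam\<^sup>2 * \<theta>\<^sup>2 + 2 * \<rho> * lam * \<sigma> * \<theta> + \<sigma>\<^sup>2) * B p / 2)"
        using y B by (intro mult_nonneg_nonneg) auto
      \<comment> \<open>Separates the part controlled by \<open>K\<close> from the part proportional
        to \<open>y\<close>, controlled by \<kappa>.\<close>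
      have split: "K - varrho - (c + d * y) * (\<theta> * B p) - (a - b * y) * B p - y / 2 * X * (B p)\<^sup>2
          + \<kappa> * B p * y = (K - varrho - \<theta> * c * B p - a * B p)
          + y * B p * (\<kappa> - \<theta> * d + b - X * B p / 2)" for X
        by (simp add: field_simps power2_eq_square)
      show ?thesis unfolding split using 1 2 by linarith
    qed
    define A where "A \<theta> = K - varrho - (c + d * y) * (\<theta> * B p) - (a - b * y) * B p
      - y / 2 * (lam\<^sup>2 * \<theta>\<^sup>2 + 2 * \<rho> * lam * \<sigma> * \<theta> + \<sigma>\<^sup>2) * (B p)\<^sup>2 + \<kappa> * B p * y" for \<theta>
    have A1: "1 \<le> A \<theta>" if "\<theta> = 1 \<or> \<theta> = -1" for \<theta>
      using coeff[OF that] by (simp only: A_def)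
    have xE: "0 \<le> x * (E 1 p - E (- 1) p)"
    proof (cases "0 \<le> x")
      case True
      then have "E (- 1) p \<le> E 1 p" using B by (simp add: E_def x_def mult_left_mono)
      then show ?thesis using True by simp
    next
      case False
      then have "E 1 p \<le> E (- 1) p" using B by (simp add: E_def x_def mult_left_mono)
      then show ?thesis using False by (simp add: mult_nonpos_nonpos)
    qed
    have "0 \<le> \<kappa> * B p" using B \<open>\<kappa> \<ge> 0\<close> by simp
    then have "0 \<le> \<kappa> * B p * (x * (E 1 p - E (- 1) p))" using xE by (rule mult_nonneg_nonneg)
    moreover have "E 1 p * 1 \<le> E 1 p * A 1" "E (- 1) p * 1 \<le> E (- 1) p * A (- 1)"
      by (intro mult_left_mono; use A1 E_pos[THEN less_imp_le] in blast)+
    moreover have "heston_op \<psi> p = E 1 p * A 1 + E (- 1) p * A (- 1)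
        + \<kappa> * B p * (x * (E 1 p - E (- 1) p))"
      unfolding \<psi>_def[abs_def] heston_op_add[OF smE smE] opE[OF y_def] A_def x_def
      by (simp add: algebra_simps)
    ultimately show "\<psi> p \<le> heston_op \<psi> p" unfolding \<psi>_def by linarith
  qed
qed

section \<open>Comparison of sub-solutions with smooth approximate solutions\<close>

text \<open>If the bound failed, some \<open>u + M \<psi>\<close> with \<open>M > \<eta>\<close>
  would touch \<open>w\<close> from above, and as a test function it would make
  \<open>heston_op u + k + M * heston_op \<psi>\<close> nonpositive there. But this is at least
  \<open>(M - \<eta>) * \<psi>\<close>, hence positive. The viscosity property enters only through
  \<open>test\<close>, so the same lemma serves \<open>w\<close> with source \<open>k\<close> and
  \<open>- v\<close> with source \<open>- k\<close>.\<close>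

lemma subsolution_le:
  assumes usc: "upper_semicontinuous_on ({s1..T} \<times> half_plane) w" "subexponential_on {s1..T} w"
    and test: "\<And>p \<phi>. p \<in> {s1<..T} \<times> half_plane \<Longrightarrow> smooth \<phi> \<Longrightarrow> \<phi> p = w p \<Longrightarrow>
      (\<And>q. q \<in> {s1..T} \<times> half_plane \<Longrightarrow> w q \<le> \<phi> q) \<Longrightarrow> heston_op \<phi> p + k p \<le> 0"
    and u: "smooth u" "subexponential_on {s1..T} u"
    and \<psi>: "smooth \<psi>" "\<And>p. p \<in> {s1..T} \<times> half_plane \<Longrightarrow> exp_weight \<epsilon> p \<le> \<psi> p"
      "\<And>p. p \<in> {s1..T} \<times> half_plane \<Longrightarrow> \<psi> p \<le> heston_op \<psi> p"
    and pos: "\<epsilon> > 0" "\<eta> > 0"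
    and init: "\<And>z. z \<in> half_plane \<Longrightarrow> w (s1, z) \<le> u (s1, z) + \<eta> * \<psi> (s1, z)"
    and source: "\<And>p. p \<in> {s1..T} \<times> half_plane \<Longrightarrow> - \<eta> * \<psi> p \<le> heston_op u p + k p"
    and q: "q \<in> {s1..T} \<times> half_plane"
  shows "w q \<le> u q + \<eta> * \<psi> q"
proof (rule ccontr)
  assume "\<not> ?thesis"
  then have "u q + \<eta> * \<psi> q < w q" by simp
  then obtain M p where M: "\<eta> < M" and p: "p \<in> {s1<..T} \<times> half_plane"
    and eq: "w p = u p + M * \<psi> p" and le: "\<And>q. q \<in> {s1..T} \<times> half_plane \<Longrightarrow> w q \<le> u q + M * \<psi> q"
    using first_touching_multiple[OF usc(1) smooth_imp_continuous_on[OF u(1)]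
        smooth_imp_continuous_on[OF \<psi>(1)] usc(2) u(2) \<psi>(2) pos init q] by metis
  have pD: "p \<in> {s1..T} \<times> half_plane" using p by auto
  have M\<psi>: "smooth (\<lambda>p. M * \<psi> p)" by (intro smooth_intros \<psi>)
  have "heston_op (\<lambda>p. u p + M * \<psi> p) p + k p \<le> 0"
    using eq le by (intro test[OF p]) (auto intro: smooth_add u(1) M\<psi>)
  then have "heston_op u p + k p + M * heston_op \<psi> p \<le> 0"
    by (simp add: heston_op_add[OF u(1) M\<psi>] heston_op_cmult[OF \<psi>(1)])
  moreover have "M * \<psi> p \<le> M * heston_op \<psi> p"
    using \<psi>(3)[OF pD] M pos by (intro mult_left_mono) auto
  moreover have "\<eta> * \<psi> p < M * \<psi> p"
    using M \<psi>(2)[OF pD] exp_weight_pos[of \<epsilon> p] by (intro mult_strict_right_mono) auto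
  ultimately show False using source[OF pD] by simp
qed

end

text \<open>The times after \<open>s1\<close> form an open set, so touching on the later strip is a
  local maximum relative to the full time interval.\<close>

lemma local_max_onI:
  fixes w \<phi> :: "real \<times> 'a::topological_space \<Rightarrow> real"
  assumes "p \<in> {s1<..T} \<times> A" "0 \<le> s1" "\<phi> p = w p" "\<And>q. q \<in> {s1..T} \<times> A \<Longrightarrow> w q \<le> \<phi> q"
  shows "local_max_on ({0<..T} \<times> A) (\<lambda>q. w q - \<phi> q) p"
proof -
  have "open (fst -` {s1<..})" by (intro open_vimage_fst open_greaterThan)
  moreover have "p \<in> fst -` {s1<..}" using assms(1) by auto
  ultimately have "\<forall>\<^sub>F q in at p within {0<..T} \<times> A. q \<in> fst -` {s1<..}"
    unfolding eventually_at_topological by blast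
  moreover have "\<forall>\<^sub>F q in at p within {0<..T} \<times> A. q \<in> {0<..T} \<times> A"
    by (simp add: eventually_at_filter)
  ultimately have "\<forall>\<^sub>F q in at p within {0<..T} \<times> A. w q - \<phi> q \<le> w p - \<phi> p"
    by eventually_elim (use assms in auto)
  then show ?thesis using assms(1,2) by (auto simp: local_max_on_def)
qed

theorem proposition4p2p15:
  fixes a b c d varrho lam \<sigma> \<rho> T :: real
    and f :: "real \<times> real \<Rightarrow> real"
    and h w v :: "real \<times> real \<times> real \<Rightarrow> real"
    and F :: "real \<Rightarrow> real \<times> real \<Rightarrow> real \<Rightarrow> real^2 \<Rightarrow> real^2^2 \<Rightarrow> real"
  assumes "a > 0" and "lam > 0" and "\<sigma> > 0" and "\<rho> \<in> {-1<..<1}" and "T > 0"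
    and "continuous_on ({0..<T} \<times> half_plane) h"
    and "polynomial_growth_on {0..<T} h"
    and F_def: "\<And>s x y r p M. F s (x, y) r p M =
          - (y / 2) * (lam\<^sup>2 * M $ 1 $ 1 + 2 * \<rho> * lam * \<sigma> * M $ 1 $ 2 + \<sigma>\<^sup>2 * M $ 2 $ 2)
          - (c + d * y) * p $ 1 - (a - b * y) * p $ 2 - varrho * r + h (T - s, x, y)"
    and "upper_semicontinuous_on ({0..T} \<times> half_plane) w"
    and "lower_semicontinuous_on ({0..T} \<times> half_plane) v"
    and "polynomial_growth_on {0..T} w"
    and "polynomial_growth_on {0..T} v"
    and "viscosity_subsolution T F f w"
    and "viscosity_supersolution T F f v"
  shows "\<forall>s\<in>{0..T}. \<forall>z\<in>half_plane. w (s, z) \<le> v (s, z)"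
proof (intro ballI)
  fix s z assume s: "s \<in> {0..T}" and z: "z \<in> half_plane"
  interpret heston a b c d varrho lam \<sigma> \<rho>
    using assms(2-4) by unfold_locales auto
  define k where "k p = h (T - fst p, snd p)" for p
  \<comment> \<open>The unknown in \<open>F\<close> is replaced by the test function, which has the
    same value at a touching point; this makes the expression linear in \<phi>.\<close>
  have op_eq: "time_deriv \<phi> p + F (fst p) (snd p) (\<phi> p) (space_grad \<phi> p) (space_hess \<phi> p)
      = heston_op \<phi> p + k p" for \<phi> p
    by (cases p) (simp add: F_def time_deriv_def space_grad_def space_hess_def space_dir_def
        heston_op_def dir_deriv_def[abs_def] k_def)
  have sub_w: "subexponential_on {0..T} w" and sub_v: "subexponential_on {0..T} v"
    and sub_h: "subexponential_on {0..<T} h"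
    using assms by (auto intro: polynomial_growth_on_imp_subexponential)
  have initial: "w (0, z) \<le> v (0, z)" if "z \<in> half_plane" for z
    using assms(13,14) that unfolding viscosity_subsolution_def viscosity_supersolution_def
    by (meson order_trans)
  have test_w: "heston_op \<phi> p + k p \<le> 0"
    if "0 \<le> s1" "p \<in> {s1<..T} \<times> half_plane" "smooth \<phi>" "\<phi> p = w p"
      "\<And>q. q \<in> {s1..T} \<times> half_plane \<Longrightarrow> w q \<le> \<phi> q" for s1 p \<phi>
  proof -
    have "local_max_on ({0<..T} \<times> half_plane) (\<lambda>q. w q - \<phi> q) (fst p, snd p)"
      using local_max_onI[OF that(2,1), of \<phi> w] that(4,5) by simp
    moreover have "fst p \<in> {0<..T}" "snd p \<in> half_plane" using that(1,2) by auto
    ultimately have "time_deriv \<phi> (fst p, snd p) + F (fst p) (snd p) (w (fst p, snd p))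
        (space_grad \<phi> (fst p, snd p)) (space_hess \<phi> (fst p, snd p)) \<le> 0"
      using assms(13) that(3) unfolding viscosity_subsolution_def by blast
    then show ?thesis using op_eq[of \<phi> p] that(4) by simp
  qed
  have test_v: "heston_op \<phi> p + - k p \<le> 0"
    if "0 \<le> s1" "p \<in> {s1<..T} \<times> half_plane" "smooth \<phi>" "\<phi> p = - v p"
      "\<And>q. q \<in> {s1..T} \<times> half_plane \<Longrightarrow> - v q \<le> \<phi> q" for s1 p \<phi>
  proof -
    have "local_max_on ({0<..T} \<times> half_plane) (\<lambda>q. - v q - \<phi> q) (fst p, snd p)"
      using local_max_onI[OF that(2,1), of \<phi> "\<lambda>q. - v q"] that(4,5) by simp
    then have "local_min_on ({0<..T} \<times> half_plane) (\<lambda>q. v q - (- \<phi> q)) (fst p, snd p)"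
      unfolding local_max_on_def local_min_on_def by (auto elim!: eventually_mono)
    moreover have "fst p \<in> {0<..T}" "snd p \<in> half_plane" using that(1,2) by auto
    ultimately have "0 \<le> time_deriv (\<lambda>q. - \<phi> q) (fst p, snd p)
        + F (fst p) (snd p) (v (fst p, snd p)) (space_grad (\<lambda>q. - \<phi> q) (fst p, snd p))
          (space_hess (\<lambda>q. - \<phi> q) (fst p, snd p))"
      using assms(14) smooth_uminus[OF that(3)] unfolding viscosity_supersolution_def by blast
    then show ?thesis using op_eq[of "\<lambda>q. - \<phi> q" p] that(4) heston_op_uminus[OF that(3)] by simp
  qed
  show "w (s, z) \<le> v (s, z)"
  proof (cases "s = 0")
    case True
    then show ?thesis using initial[OF z] by simp
  next
    case False
    then have s0: "0 < s" "s \<le> T" using s by auto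
    obtain \<epsilon> \<psi> where \<epsilon>: "\<epsilon> > 0" and \<psi>: "smooth \<psi>"
      "\<And>p. p \<in> {0..T} \<times> half_plane \<Longrightarrow> exp_weight \<epsilon> p \<le> \<psi> p"
      "\<And>p. p \<in> {0..T} \<times> half_plane \<Longrightarrow> \<psi> p \<le> heston_op \<psi> p"
      using barrier_exists by metis
    \<comment> \<open>Each of the two comparisons with the smooth \<open>u\<close> costs
      \<open>5 * \<eta>\<close> times the barrier.\<close>
    have main: "w (s, z) - v (s, z) \<le> 10 * \<eta> * \<psi> (s, z)" if \<eta>: "\<eta> > 0" for \<eta>
    proof -
      obtain s1 where s1: "0 < s1" "s1 < s"
        "\<And>z. z \<in> half_plane \<Longrightarrow> w (s1, z) < v (s1, z) + \<eta> * exp_weight \<epsilon> (s1, z)"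
        using initial_layer[OF assms(9) sub_w assms(10) sub_v initial \<epsilon> \<eta> s0] by blast
      have s1T: "s1 \<le> T" and subset: "{s1..T} \<subseteq> {0..T}"
        and subset_D: "{s1..T} \<times> half_plane \<subseteq> {0..T} \<times> half_plane" using s0 s1 by auto
      have w: "upper_semicontinuous_on ({s1..T} \<times> half_plane) w" "subexponential_on {s1..T} w"
        by (rule upper_semicontinuous_on_subset[OF assms(9) subset_D]
            subexponential_on_subset[OF sub_w subset])+
      have minus_v: "upper_semicontinuous_on ({s1..T} \<times> half_plane) (\<lambda>p. - v p)"
        by (rule upper_semicontinuous_on_subset[OF lower_semicontinuous_on_uminus[OF assms(10)] subset_D])
      have v: "lower_semicontinuous_on ({s1..T} \<times> half_plane) v" "subexponential_on {s1..T} v"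
        by (rule lower_semicontinuous_on_subset[OF assms(10) subset_D]
            subexponential_on_subset[OF sub_v subset])+
      obtain g where g: "continuous_on ({s1..T} \<times> half_plane) g" "subexponential_on {s1..T} g"
        "\<And>z. z \<in> half_plane \<Longrightarrow> w (s1, z) \<le> g (s1, z) + 4 * \<eta> * exp_weight \<epsilon> (s1, z)"
        "\<And>z. z \<in> half_plane \<Longrightarrow> g (s1, z) \<le> v (s1, z) + 4 * \<eta> * exp_weight \<epsilon> (s1, z)"
        using initial_insertion[OF s1T w v s1(3) \<epsilon> \<eta>] by metis
      \<comment> \<open>Since \<open>s1 > 0\<close>, the reversed time \<open>T - fst p\<close>
        stays below \<open>T\<close>, where \<open>h\<close> is known to be continuous.\<close>
      have "continuous_on ({s1..T} \<times> half_plane) (\<lambda>p. h (T - fst p, snd p))"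
        by (rule continuous_on_compose2[OF assms(6)]) (use s1(1) in \<open>auto intro!: continuous_intros\<close>)
      then have k1: "continuous_on ({s1..T} \<times> half_plane) k" by (simp add: k_def[abs_def])
      have k2: "subexponential_on {s1..T} k"
        unfolding subexponential_on_def
      proof (intro allI impI)
        fix \<delta> :: real assume "\<delta> > 0"
        then obtain C where "\<And>p. p \<in> {0..<T} \<times> half_plane \<Longrightarrow> \<bar>h p\<bar> \<le> C * exp_weight \<delta> p"
          using subexponential_onE[OF sub_h] by metis
        then have "\<bar>k p\<bar> \<le> C * exp_weight \<delta> p" if "p \<in> {s1..T} \<times> half_plane" for p
          using that s1(1) unfolding k_def exp_weight_def by fastforce
        then show "\<exists>C. \<forall>p\<in>{s1..T} \<times> half_plane. \<bar>k p\<bar> \<le> C * exp_weight \<delta> p" by blast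
      qed
      obtain u where u: "smooth u" "subexponential_on {s1..T} u"
        "\<And>z. z \<in> half_plane \<Longrightarrow> \<bar>u (s1, z) - g (s1, z)\<bar> \<le> \<eta> * exp_weight \<epsilon> (s1, z)"
        "\<And>p. p \<in> {s1..T} \<times> half_plane \<Longrightarrow> \<bar>heston_op u p + k p\<bar> \<le> \<eta> * exp_weight \<epsilon> p"
        using approximate_solution[OF s1T g(1,2) k1 k2 \<epsilon> \<eta>] by metis
      have \<psi>': "exp_weight \<epsilon> p \<le> \<psi> p" "\<psi> p \<le> heston_op \<psi> p" "\<eta> * exp_weight \<epsilon> p \<le> \<eta> * \<psi> p"
        "0 \<le> \<eta> * \<psi> p"
        if "p \<in> {s1..T} \<times> half_plane" for p
      proof -
        have "p \<in> {0..T} \<times> half_plane" using that subset_D by blast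
        from \<psi>(2)[OF this] \<psi>(3)[OF this] show "exp_weight \<epsilon> p \<le> \<psi> p" "\<psi> p \<le> heston_op \<psi> p" .
        then show "\<eta> * exp_weight \<epsilon> p \<le> \<eta> * \<psi> p" "0 \<le> \<eta> * \<psi> p"
          using \<eta> exp_weight_pos[of \<epsilon> p] by auto
      qed
      \<comment> \<open>The 5 collects 4 from the insertion and 1 from the initial error of
        \<open>u\<close>; the source error needs only 1.\<close>
      have \<eta>5: "5 * \<eta> > 0" using \<eta> by simp
      have slice: "(s1, z) \<in> {s1..T} \<times> half_plane" if "z \<in> half_plane" for z
        using that s1T by simp
      have q: "(s, z) \<in> {s1..T} \<times> half_plane" using z s0 s1 by simp
      have "w (s, z) \<le> u (s, z) + 5 * \<eta> * \<psi> (s, z)"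
      proof (rule subsolution_le[OF w test_w u(1,2) \<psi>(1) \<psi>'(1,2) \<epsilon> \<eta>5 _ _ q])
        show "w (s1, z) \<le> u (s1, z) + 5 * \<eta> * \<psi> (s1, z)" if "z \<in> half_plane" for z
          using g(3)[OF that] u(3)[OF that] \<psi>'(3)[OF slice[OF that]] by linarith
        show "- (5 * \<eta>) * \<psi> p \<le> heston_op u p + k p" if "p \<in> {s1..T} \<times> half_plane" for p
          using u(4)[OF that] \<psi>'(3,4)[OF that] by linarith
      qed (use s1(1) in auto)
      moreover have "- v (s, z) \<le> - u (s, z) + 5 * \<eta> * \<psi> (s, z)"
      proof (rule subsolution_le[OF minus_v subexponential_on_uminus[OF v(2)] test_v
            smooth_uminus[OF u(1)] subexponential_on_uminus[OF u(2)] \<psi>(1) \<psi>'(1,2) \<epsilon> \<eta>5 _ _ q])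
        show "- v (s1, z) \<le> - u (s1, z) + 5 * \<eta> * \<psi> (s1, z)" if "z \<in> half_plane" for z
          using g(4)[OF that] u(3)[OF that] \<psi>'(3)[OF slice[OF that]] by linarith
        show "- (5 * \<eta>) * \<psi> p \<le> heston_op (\<lambda>p. - u p) p + - k p" if "p \<in> {s1..T} \<times> half_plane" for p
          using u(4)[OF that] \<psi>'(3,4)[OF that] heston_op_uminus[OF u(1), of p] by linarith
      qed (use s1(1) in auto)
      ultimately show ?thesis by linarith
    qed
    have "0 < \<psi> (s, z)"
      using \<psi>(2)[of "(s, z)"] exp_weight_pos[of \<epsilon> "(s, z)"] s z by auto
    show ?thesis
    proof (rule ccontr)
      assume "\<not> ?thesis"
      then have "0 < w (s, z) - v (s, z)" by simp
      \<comment> \<open>\<eta> is chosen to make the error bound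
        \<open>10 * \<eta> * \<psi> (s, z)\<close> half of the supposed gap.\<close>
      then have "w (s, z) - v (s, z) \<le> (w (s, z) - v (s, z)) / 2"
        using main[of "(w (s, z) - v (s, z)) / (20 * \<psi> (s, z))"] \<open>0 < \<psi> (s, z)\<close> by simp
      then show False using \<open>0 < w (s, z) - v (s, z)\<close> by simp
    qed
  qed
qed

end
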